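(* Let $0\le m\le n$ be integers, let $A$ be an $n$-qubit space and $\delta\in\mathbb R$. For a $\delta$-almost universal$_2$ random function $G:\{0,1\}^n\to\{0,1\}^{n-m}$ (taking values in surjective linear functions) and for a sub-normalized state $\rho_{X^AB}=\sum_x|\tilde x\rangle\langle\tilde x|_A\otimes\tilde\rho^x_B$, $${\rm E}_G\,Q^{{\rm EC},G}(\rho_{X^AB})={\rm E}_G\,Q^{{\rm DC},G}(\rho_{X^AB})\le 2^{H_{\rm max}(X^A|B)_\rho-(n-m)}\,\delta.$$
   Context: All Hilbert spaces are finite-dimensional; logarithms are base 2 (with $2^{-\infty}=0$). A sub-normalized state is a positive semidefinite operator of trace at most 1; $\{|\tilde x\rangle\}_{x\in\{0,1\}^n}$ is the $x$ basis of $A=(\mathbb C^2)^{\otimes n}$, i.e. the product eigenbasis of the Pauli $\sigma_X$'s ($\sigma_X|\tilde x_i\rangle=(-1)^{x_i}|\tilde x_i\rangle$ on each qubit). A linear random function $G:\{0,1\}^n\to\{0,1\}^{n-m}$ is a random variable with values in a finite set of $\mathbb F_2$-linear functions, and ${\rm E}_G\,r(G)=\sum_g\Pr[G=g]\,r(g)$. It is $\delta$-almost universal$_2$ if $\Pr[G(x)=0]\le2^{-(n-m)}\delta$ for all $x\ne0$. Error correction with quantum side information: given $x$ and $\tilde\rho^x_B$, the receiver computes $s=g(x)$, measures $B$ by a POVM $M^s=\{M^{s,e}\}_{e\in\{0,1\}^n}$, outputs $y=x+e$, and fails if $y\ne0$: $Q^{{\rm EC},g}(\rho_{X^AB})=\min_{\{M^s\}}\sum_x\sum_{e:\,x+e\ne0}{\rm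 Tr}(\tilde\rho^xM^{g(x),e})$. Data compression with quantum side information: the decoder receives $s=g(x)$ and $\tilde\rho^x_B$, measures $B$ by a POVM $M^s$, outputs $x'=e$, and fails if $x'\ne x$: $Q^{{\rm DC},g}(\rho_{X^AB})=\min_{\{M^s\}}\sum_x\sum_{e\ne x}{\rm Tr}(\tilde\rho^xM^{g(x),e})$. The minima are over all families of POVMs indexed by $s\in\{0,1\}^{n-m}$. $H_{\rm max}(X^A|B)_\rho=\max_{\sigma_B\ge0,{\rm Tr}\sigma=1}\log\big(2^n\,\|\sqrt{\rho_{X^AB}}\sqrt{2^{-n}I_A\otimes\sigma_B}\|_1^2\big)$.
   Formalization: For n = 0 the formal theorem also assumes δ ≥ 0, since almost universality is then vacuous and the claim fails (e.g. ρ = 1, δ = −1 gives 0 ≤ −1); for n ≥ 1, δ ≥ 0 follows from almost universality. *)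

theory Defs
  imports
    "HOL-Probability.Probability_Mass_Function"
    "HOL-Library.Z2"
    "Jordan_Normal_Form.Schur_Decomposition"
begin

hide_type (open) Finite_Cartesian_Product.vec
hide_const (open) Finite_Cartesian_Product.vec

definition mtrace :: "complex mat \<Rightarrow> complex" where
  "mtrace X = (\<Sum>i<dim_row X. X $$ (i, i))"

text \<open>The order on \<^typ>\<open>complex\<close> is the one of \<^theory>\<open>HOL-Library.Complex_Order\<close>, so
  \<open>0 \<le> z\<close> says that \<open>z\<close> is real and nonnegative.\<close>

definition psd :: "nat \<Rightarrow> complex mat \<Rightarrow> bool" where
  "psd N X \<longleftrightarrow> X \<in> carrier_mat N N \<and> (\<forall>v\<in>carrier_vec N. 0 \<le> (X *\<^sub>v v) \<bullet>c v)"

text \<open>The unique positive semidefinite root; meaningful for positive semidefinite arguments only.\<close>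

definition msqrt :: "complex mat \<Rightarrow> complex mat" where
  "msqrt X = (THE S. psd (dim_row X) S \<and> S * S = X)"

definition trace_norm :: "complex mat \<Rightarrow> real" where
  "trace_norm X = Re (mtrace (msqrt (mat_adjoint X * X)))"

definition kron :: "complex mat \<Rightarrow> complex mat \<Rightarrow> complex mat" where
  "kron X Y = mat (dim_row X * dim_row Y) (dim_col X * dim_col Y)
     (\<lambda>(i, j). X $$ (i div dim_row Y, j div dim_col Y) * Y $$ (i mod dim_row Y, j mod dim_col Y))"

definition msum :: "nat \<Rightarrow> ('i \<Rightarrow> complex mat) \<Rightarrow> 'i set \<Rightarrow> complex mat" where
  "msum N X I = mat N N (\<lambda>(i, j). \<Sum>k\<in>I. X k $$ (i, j))"

definition subnormalized_state :: "nat \<Rightarrow> complex mat \<Rightarrow> bool" where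
  "subnormalized_state N X \<longleftrightarrow> psd N X \<and> mtrace X \<le> 1"

definition normalized_state :: "nat \<Rightarrow> complex mat \<Rightarrow> bool" where
  "normalized_state N X \<longleftrightarrow> psd N X \<and> mtrace X = 1"

text \<open>Bit strings of length \<open>n\<close> are the elements of \<open>carrier_vec n :: bit vec set\<close>, that is,
  of \<open>\<bbbF>\<^sub>2\<close> to the power \<open>n\<close>. Kets are matrices with one column, and the \<open>n\<close>-qubit space
  is the \<open>2 ^ n\<close>-dimensional space with the tensor products of computational basis vectors as
  standard basis.\<close>

definition qubit_xket :: "bit \<Rightarrow> complex mat" where
  "qubit_xket b = mat 2 1 (\<lambda>(i, j). (if b = 1 \<and> i = 1 then -1 else 1) / sqrt 2)"

definition pauli_x :: "complex mat" where
  "pauli_x = mat 2 2 (\<lambda>(i, j). if i = j then 0 else 1)"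

lemma pauli_x_qubit_xket:
  "pauli_x * qubit_xket b = (if b = 1 then -1 else 1) \<cdot>\<^sub>m qubit_xket b"
  by (rule eq_matI)
    (auto simp: pauli_x_def qubit_xket_def scalar_prod_def numeral_2_eq_2 less_Suc_eq
      split: if_splits)

definition xket :: "bit vec \<Rightarrow> complex mat" where
  "xket x = foldr (\<lambda>b. kron (qubit_xket b)) (list_of_vec x) (1\<^sub>m 1)"

definition xproj :: "bit vec \<Rightarrow> complex mat" where
  "xproj x = xket x * mat_adjoint (xket x)"

text \<open>The operator \<open>\<Sum>\<^sub>x |x~\<rangle>\<langle>x~| \<otimes> \<rho> x\<close> on \<open>n\<close> qubits and a \<open>d\<close>-dimensional
  system \<open>B\<close>.\<close>

definition cq_operator :: "nat \<Rightarrow> nat \<Rightarrow> (bit vec \<Rightarrow> complex mat) \<Rightarrow> complex mat" where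
  "cq_operator n d \<rho> = msum (2 ^ n * d) (\<lambda>x. kron (xproj x) (\<rho> x)) (carrier_vec n)"

definition log2_ereal :: "real \<Rightarrow> ereal" where
  "log2_ereal t = (if t > 0 then ereal (log 2 t) else -\<infinity>)"

definition pow2_ereal :: "ereal \<Rightarrow> ereal" where
  "pow2_ereal h = (case h of ereal r \<Rightarrow> ereal (2 powr r) | PInfty \<Rightarrow> \<infinity> | MInfty \<Rightarrow> 0)"

text \<open>The value is \<open>-\<infinity>\<close> for the zero operator. The functional is continuous in \<open>\<sigma>\<close> on the
  compact set of normalized states, so the supremum is a maximum when \<open>d > 0\<close>.\<close>

definition H_max :: "nat \<Rightarrow> nat \<Rightarrow> complex mat \<Rightarrow> ereal" where
  "H_max n d \<rho>AB = (SUP \<sigma>\<in>{\<sigma>. normalized_state d \<sigma>}.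
     log2_ereal (2 ^ n * (trace_norm (msqrt \<rho>AB * msqrt (kron ((1 / 2 ^ n) \<cdot>\<^sub>m 1\<^sub>m (2 ^ n)) \<sigma>)))\<^sup>2))"

definition povm :: "nat \<Rightarrow> nat \<Rightarrow> (bit vec \<Rightarrow> complex mat) \<Rightarrow> bool" where
  "povm n d M \<longleftrightarrow> (\<forall>e\<in>carrier_vec n. psd d (M e)) \<and> msum d M (carrier_vec n) = 1\<^sub>m d"

text \<open>\<open>n\<close> is the length of the outcomes, \<open>k\<close> that of the syndromes.\<close>

definition povm_families :: "nat \<Rightarrow> nat \<Rightarrow> nat \<Rightarrow> (bit vec \<Rightarrow> bit vec \<Rightarrow> complex mat) set" where
  "povm_families n k d = {M. \<forall>s\<in>carrier_vec k. povm n d (M s)}"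

text \<open>The set of POVM families is nonempty and, up to irrelevant arguments, compact, and the
  objectives are linear; so the infima are minima. They depend only on \<open>\<rho>\<close> on
  \<open>carrier_vec n\<close>, hence only on \<open>cq_operator n d \<rho>\<close>.\<close>

definition Q_EC :: "nat \<Rightarrow> nat \<Rightarrow> nat \<Rightarrow> (bit vec \<Rightarrow> bit vec) \<Rightarrow> (bit vec \<Rightarrow> complex mat) \<Rightarrow> real" where
  "Q_EC n k d g \<rho> = (INF M\<in>povm_families n k d.
     \<Sum>x\<in>carrier_vec n. \<Sum>e\<in>{e\<in>carrier_vec n. x + e \<noteq> 0\<^sub>v n}. Re (mtrace (\<rho> x * M (g x) e)))"

definition Q_DC :: "nat \<Rightarrow> nat \<Rightarrow> nat \<Rightarrow> (bit vec \<Rightarrow> bit vec) \<Rightarrow> (bit vec \<Rightarrow> complex mat) \<Rightarrow> real" where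
  "Q_DC n k d g \<rho> = (INF M\<in>povm_families n k d.
     \<Sum>x\<in>carrier_vec n. \<Sum>e\<in>{e\<in>carrier_vec n. e \<noteq> x}. Re (mtrace (\<rho> x * M (g x) e)))"

text \<open>A random function is represented by its distribution. Only the restriction of a function
  to \<open>carrier_vec n\<close> matters.\<close>

definition linear_fun :: "nat \<Rightarrow> nat \<Rightarrow> (bit vec \<Rightarrow> bit vec) \<Rightarrow> bool" where
  "linear_fun n k g \<longleftrightarrow>
     g \<in> module_hom class_ring (module_vec TYPE(bit) n) (module_vec TYPE(bit) k)"

definition linear_random_function :: "nat \<Rightarrow> nat \<Rightarrow> (bit vec \<Rightarrow> bit vec) pmf \<Rightarrow> bool" where
  "linear_random_function n k G \<longleftrightarrow> finite (set_pmf G) \<and> (\<forall>g\<in>set_pmf G. linear_fun n k g)"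

definition almost_universal2 :: "nat \<Rightarrow> nat \<Rightarrow> real \<Rightarrow> (bit vec \<Rightarrow> bit vec) pmf \<Rightarrow> bool" where
  "almost_universal2 n k \<delta> G \<longleftrightarrow>
     (\<forall>x\<in>carrier_vec n. x \<noteq> 0\<^sub>v n \<longrightarrow>
        measure_pmf.prob G {g. g x = 0\<^sub>v k} \<le> 2 powr (- real k) * \<delta>)"

text \<open>For \<open>n = 0\<close> there is no nonzero bit string, so \<^const>\<open>almost_universal2\<close> does not
  constrain \<open>\<delta>\<close>. For \<open>n > 0\<close> it forces \<open>\<delta>\<close> to be nonnegative.\<close>

lemma almost_universal2_nonneg:
  assumes "almost_universal2 n k \<delta> G" and "0 < n"
  shows "0 \<le> \<delta>"
proof -
  have "unit_vec n 0 \<noteq> (0\<^sub>v n :: bit vec)"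
    using assms(2) by (metis index_unit_vec(2) index_zero_vec(1) zero_neq_one)
  then have "measure_pmf.prob G {g. g (unit_vec n 0) = 0\<^sub>v k} \<le> 2 powr (- real k) * \<delta>"
    using assms(1) by (auto simp: almost_universal2_def)
  then have "0 \<le> 2 powr (- real k) * \<delta>"
    using measure_nonneg order_trans by blast
  then show ?thesis
    by (simp add: zero_le_mult_iff)
qed

end

theory Submission
  imports Defs "Jordan_Normal_Form.Spectral_Radius"
begin

text \<open>Since \<open>x + e = 0\<close> means \<open>e = x\<close> over \<open>\<bbbF>\<^sub>2\<close>, the two objectives coincide. For the bound let
  \<open>r\<^sub>x\<close> be the root of \<open>\<rho>\<^sub>x\<close> and measure, given a syndrome, with
  \<open>M\<^sub>x = T r\<^sub>x T\<close>, where \<open>\<Lambda>\<close> is the sum of the \<open>r\<^sub>y\<close> with that syndrome and \<open>T\<close> the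
  pseudo-inverse of its root. In an
  eigenbasis of \<open>r\<^sub>x\<close>, convexity of \<open>t \<mapsto> 1 / sqrt t\<close> bounds the error on \<open>x\<close> by
  \<open>Tr r\<^sub>x (\<Lambda> - r\<^sub>x)\<close>, a sum over the strings that collide with \<open>x\<close>. Averaging over the hash
  function gives \<open>\<delta> Tr R\<^sup>2\<close> divided by \<open>2 ^ (n - m)\<close>, with \<open>R\<close> the sum of all \<open>r\<^sub>x\<close>. Finally
  \<open>Tr R\<^sup>2\<close> is at most 2 to the power \<open>H_max\<close>: take \<open>\<sigma> = R\<^sup>2 / Tr R\<^sup>2\<close> and use that the
  trace norm dominates the real part of the trace.\<close>

subsection \<open>Adjoints and traces\<close>

text \<open>The entropy is built from an overlap of square roots, so the error has to be controlled
  by the pairwise overlaps Tr \<open>r x * r y\<close>; this is why the measurement is assembled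
  from the roots and not from the \<open>\<rho> x\<close>. The obstacle is that \<open>r x\<close>
  does not commute with the sum \<Lambda>. What has to be shown is Tr
  \<open>r x * r x * T * r x * T\<close> \<ge> 2 Tr \<open>r x * r x\<close> - Tr
  \<open>r x * \<Lambda>\<close>. In an eigenbasis of \<open>r x\<close> the left side is a sum of
  nonnegative terms, of which the diagonal ones suffice. They involve only diagonal entries of
  \<open>T\<close>, and Tr \<open>r x * \<Lambda>\<close> only those of \<Lambda>; both are means
  over the spectrum of \<Lambda> with the same weights, so a scalar inequality finishes. That
  inequality is tight when \<open>x\<close> collides with nothing, where the error is 0, and this
  keeps the factor in front of \<delta> equal to 1. On the entropy side a lower bound on a supremum
  is wanted, hence a single witness \<sigma>. By Cauchy-Schwarz the overlap of \<open>R\<close> with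
  the root of \<sigma> is largest when that root is proportional to \<open>R\<close>, which dictates
  the choice.\<close>

declare index_mult_mat(1) [simp del]

abbreviation adj :: "complex mat \<Rightarrow> complex mat" where
  "adj \<equiv> mat_adjoint"

lemma dim_adj [simp]: "dim_row (adj A) = dim_col A" "dim_col (adj A) = dim_row A"
  by (auto simp: mat_adjoint_def)

lemma adj_carrier [simp]: "A \<in> carrier_mat n m \<Longrightarrow> adj A \<in> carrier_mat m n"
  by auto

lemma index_adj [simp]:
  "i < dim_col A \<Longrightarrow> j < dim_row A \<Longrightarrow> adj A $$ (i, j) = cnj (A $$ (j, i))"
  by (auto simp: mat_adjoint_def mat_of_rows_def)

lemma adj_adj [simp]: "adj (adj A) = A"
  by (rule eq_matI) auto

lemma adj_one [simp]: "adj (1\<^sub>m n) = 1\<^sub>m n"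
  by (rule eq_matI) auto

text \<open>Replaces the simp rule removed above: plain sums over \<open>{..<m}\<close> can be
  swapped and reindexed, whereas that rule produces scalar products of rows and columns.\<close>

lemma index_mult:
  assumes "A \<in> carrier_mat n m" "B \<in> carrier_mat m p" "i < n" "j < p"
  shows "(A * B) $$ (i, j) = (\<Sum>k<m. A $$ (i, k) * B $$ (k, j))"
  using assms by (auto simp: index_mult_mat(1) scalar_prod_def lessThan_atLeast0 intro!: sum.cong)

lemma index_conj:
  assumes A: "A \<in> carrier_mat n n" and C: "C \<in> carrier_mat n m" and ij: "i < m" "j < m"
  shows "(adj C * A * C) $$ (i, j) = (\<Sum>b<n. \<Sum>a<n. cnj (C $$ (a, i)) * A $$ (a, b) * C $$ (b, j))"
proof -
  have CA: "adj C * A \<in> carrier_mat m n" using A C by auto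
  have "(adj C * A) $$ (i, b) = (\<Sum>a<n. cnj (C $$ (a, i)) * A $$ (a, b))" if "b < n" for b
    using that C ij by (subst index_mult[OF adj_carrier[OF C] A]) auto
  then show ?thesis
    using ij by (subst index_mult[OF CA C]) (auto simp: sum_distrib_right)
qed

lemma adj_mult:
  assumes "A \<in> carrier_mat n m" "B \<in> carrier_mat m p"
  shows "adj (A * B) = adj B * adj A"
proof (rule eq_matI)
  fix i j assume "i < dim_row (adj B * adj A)" "j < dim_col (adj B * adj A)"
  then have ij: "i < p" "j < n" using assms by auto
  have "adj (A * B) $$ (i, j) = (\<Sum>k<m. cnj (A $$ (j, k) * B $$ (k, i)))"
    using assms ij by (simp add: index_mult[OF assms])
  also have "\<dots> = (adj B * adj A) $$ (i, j)"
    using assms ij by (subst index_mult[of _ p m _ n]) (auto simp: mult.commute intro!: sum.cong)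
  finally show "adj (A * B) $$ (i, j) = (adj B * adj A) $$ (i, j)" .
qed (use assms in auto)

lemma mtrace_comm:
  assumes "A \<in> carrier_mat n m" "B \<in> carrier_mat m n"
  shows "mtrace (A * B) = mtrace (B * A)"
proof -
  have "mtrace (A * B) = (\<Sum>i<n. \<Sum>k<m. A $$ (i, k) * B $$ (k, i))"
    using assms by (auto simp: mtrace_def index_mult[OF assms] intro!: sum.cong)
  also have "\<dots> = (\<Sum>k<m. \<Sum>i<n. B $$ (k, i) * A $$ (i, k))"
    by (subst sum.swap) (simp add: mult.commute)
  also have "\<dots> = mtrace (B * A)"
    using assms by (auto simp: mtrace_def index_mult[OF assms(2,1)] intro!: sum.cong)
  finally show ?thesis .
qed

lemma msum_carrier [simp]: "msum n f I \<in> carrier_mat n n"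
  by (simp add: msum_def)

lemma mtrace_msum:
  assumes "\<And>k. k \<in> I \<Longrightarrow> f k \<in> carrier_mat n n"
  shows "mtrace (msum n f I) = (\<Sum>k\<in>I. mtrace (f k))"
proof -
  have "mtrace (msum n f I) = (\<Sum>i<n. \<Sum>k\<in>I. f k $$ (i, i))"
    by (simp add: mtrace_def msum_def)
  also have "\<dots> = (\<Sum>k\<in>I. mtrace (f k))"
    using assms by (subst sum.swap) (auto simp: mtrace_def intro!: sum.cong)
  finally show ?thesis .
qed

lemma mult_msum:
  assumes A: "A \<in> carrier_mat n n" and f: "\<And>k. k \<in> I \<Longrightarrow> f k \<in> carrier_mat n n"
  shows "A * msum n f I = msum n (\<lambda>k. A * f k) I"
proof (rule eq_matI)
  fix i j assume "i < dim_row (msum n (\<lambda>k. A * f k) I)" "j < dim_col (msum n (\<lambda>k. A * f k) I)"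
  then have ij: "i < n" "j < n" by (auto simp: msum_def)
  have "(A * msum n f I) $$ (i, j) = (\<Sum>l<n. \<Sum>k\<in>I. A $$ (i, l) * f k $$ (l, j))"
    unfolding index_mult[OF A msum_carrier ij] using ij by (simp add: msum_def sum_distrib_left)
  also have "\<dots> = (\<Sum>k\<in>I. (A * f k) $$ (i, j))"
    using ij by (subst sum.swap) (auto simp: index_mult[OF A f] intro!: sum.cong)
  finally show "(A * msum n f I) $$ (i, j) = msum n (\<lambda>k. A * f k) I $$ (i, j)"
    using ij by (simp add: msum_def)
qed (use A in \<open>auto simp: msum_def\<close>)

lemma msum_mult:
  assumes A: "A \<in> carrier_mat n n" and f: "\<And>k. k \<in> I \<Longrightarrow> f k \<in> carrier_mat n n"
  shows "msum n f I * A = msum n (\<lambda>k. f k * A) I"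
proof (rule eq_matI)
  fix i j assume "i < dim_row (msum n (\<lambda>k. f k * A) I)" "j < dim_col (msum n (\<lambda>k. f k * A) I)"
  then have ij: "i < n" "j < n" by (auto simp: msum_def)
  have "(msum n f I * A) $$ (i, j) = (\<Sum>l<n. \<Sum>k\<in>I. f k $$ (i, l) * A $$ (l, j))"
    unfolding index_mult[OF msum_carrier A ij] using ij by (simp add: msum_def sum_distrib_right)
  also have "\<dots> = (\<Sum>k\<in>I. (f k * A) $$ (i, j))"
    using ij by (subst sum.swap) (auto simp: index_mult[OF f A] intro!: sum.cong)
  finally show "(msum n f I * A) $$ (i, j) = msum n (\<lambda>k. f k * A) I $$ (i, j)"
    using ij by (simp add: msum_def)
qed (use A in \<open>auto simp: msum_def\<close>)

lemma msum_cong: "(\<And>k. k \<in> I \<Longrightarrow> f k = g k) \<Longrightarrow> msum n f I = msum n g I"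
  by (simp add: msum_def)

lemma msum_delta:
  assumes "finite I" "a \<in> I" "f a \<in> carrier_mat n n"
  shows "msum n (\<lambda>k. if k = a then f k else 0\<^sub>m n n) I = f a"
  by (rule eq_matI)
    (use assms in \<open>auto simp: msum_def if_distrib[of "\<lambda>A. A $$ _"] sum.delta cong: if_cong\<close>)

subsection \<open>Positive semidefinite matrices\<close>

lemma cscalar_prod_mult_eq:
  assumes "A \<in> carrier_mat n m" "v \<in> carrier_vec m" "w \<in> carrier_vec n"
  shows "(A *\<^sub>v v) \<bullet>c w = (\<Sum>i<n. \<Sum>j<m. cnj (w $ i) * A $$ (i, j) * v $ j)"
  using assms
  by (auto simp: scalar_prod_def lessThan_atLeast0 sum_distrib_left sum_distrib_right mult.assoc
      mult.commute mult.left_commute intro!: sum.cong)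

lemma psd_carrier: "psd n A \<Longrightarrow> A \<in> carrier_mat n n"
  by (simp add: psd_def)

text \<open>Coordinate form with test vectors as functions, so that they can be written as lambda
  terms and the double sum can be interchanged with other sums.\<close>

lemma psd_alt:
  "psd n A \<longleftrightarrow> A \<in> carrier_mat n n \<and>
     (\<forall>v. 0 \<le> (\<Sum>i<n. \<Sum>j<n. cnj (v i) * A $$ (i, j) * v j))" (is "_ \<longleftrightarrow> _ \<and> ?R")
proof (cases "A \<in> carrier_mat n n")
  case A: True
  have "(\<forall>v\<in>carrier_vec n. 0 \<le> (A *\<^sub>v v) \<bullet>c v) \<longleftrightarrow> ?R"
  proof (intro iffI allI ballI)
    fix v :: "nat \<Rightarrow> complex" assume "\<forall>v\<in>carrier_vec n. 0 \<le> (A *\<^sub>v v) \<bullet>c v"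
    then have "0 \<le> (A *\<^sub>v vec n v) \<bullet>c vec n v" by simp
    then show "0 \<le> (\<Sum>i<n. \<Sum>j<n. cnj (v i) * A $$ (i, j) * v j)"
      by (simp add: cscalar_prod_mult_eq[OF A])
  qed (auto simp: cscalar_prod_mult_eq[OF A])
  with A show ?thesis by (simp add: psd_def)
qed (simp add: psd_def)

lemma cnj_of_bool [simp]: "cnj (of_bool b) = of_bool b"
  by (cases b) auto

text \<open>Polarization: the form at the \<open>i\<close>-th basis vector plus \<open>c\<close>
  times the \<open>j\<close>-th is real. For \<open>c = 1\<close> this gives opposite imaginary
  parts of the entries at \<open>(i, j)\<close> and \<open>(j, i)\<close>, for the imaginary unit it
  gives equal real parts.\<close>

lemma psd_hermitian:
  assumes "psd n A"
  shows "adj A = A"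
proof (rule eq_matI)
  have A: "A \<in> carrier_mat n n" using assms by (rule psd_carrier)
  fix i j assume "i < dim_row A" "j < dim_col A"
  then have ij: "i < n" "j < n" using A by auto
  have form: "0 \<le> (\<Sum>a<n. \<Sum>b<n. cnj (v a) * A $$ (a, b) * v b)" for v
    using assms by (simp add: psd_alt)
  have pol: "0 \<le> A $$ (i, i) + c * A $$ (i, j) + cnj c * A $$ (j, i) + cnj c * c * A $$ (j, j)"
    if "i \<noteq> j" for c
  proof -
    have "(\<Sum>a<n. \<Sum>b<n. cnj (of_bool (a = i) + c * of_bool (a = j)) * A $$ (a, b)
            * (of_bool (b = i) + c * of_bool (b = j)))
        = (\<Sum>a<n. cnj (of_bool (a = i) + c * of_bool (a = j)) * (A $$ (a, i) + c * A $$ (a, j)))"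
      using ij by (intro sum.cong refl)
        (simp add: algebra_simps sum.distrib flip: sum_distrib_left)
    also have "\<dots> = A $$ (i, i) + c * A $$ (i, j) + cnj c * A $$ (j, i) + cnj c * c * A $$ (j, j)"
      using ij by (simp add: algebra_simps sum.distrib flip: sum_distrib_left)
    finally show ?thesis using form[of "\<lambda>a. of_bool (a = i) + c * of_bool (a = j)"] by simp
  qed
  have diag: "Im (A $$ (k, k)) = 0" if "k < n" for k
  proof -
    have "(\<Sum>a<n. \<Sum>b<n. cnj (of_bool (a = k)) * A $$ (a, b) * of_bool (b = k)) = A $$ (k, k)"
      using that by (simp add: mult.assoc flip: sum_distrib_left)
    then show ?thesis using form[of "\<lambda>a. of_bool (a = k)"] by (simp add: less_eq_complex_def)
  qed
  show "adj A $$ (i, j) = A $$ (i, j)"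
  proof (cases "i = j")
    case True
    then show ?thesis using ij A diag[of i] by (simp add: complex_eq_iff)
  next
    case False
    from pol[OF False, of 1] pol[OF False, of \<i>] show ?thesis
      using ij A diag[of i] diag[of j] by (auto simp: complex_eq_iff less_eq_complex_def)
  qed
qed (use psd_carrier[OF assms] in auto)

text \<open>The form at \<open>v\<close> is the form of \<open>A\<close> at \<open>C v\<close>,
  called \<open>w\<close> below. \<open>C\<close> is rectangular, so this covers both the embedding
  of a block and the compression to it.\<close>

lemma psd_conj:
  assumes "psd n A" and C: "C \<in> carrier_mat n m"
  shows "psd m (adj C * A * C)"
  unfolding psd_alt
proof (intro conjI allI)
  have A: "A \<in> carrier_mat n n" using assms(1) by (rule psd_carrier)
  show "adj C * A * C \<in> carrier_mat m m" using A C by auto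
  fix v
  define w where "w a = (\<Sum>i<m. C $$ (a, i) * v i)" for a
  have "(\<Sum>i<m. \<Sum>j<m. cnj (v i) * (adj C * A * C) $$ (i, j) * v j)
      = (\<Sum>i<m. \<Sum>j<m. \<Sum>b<n. \<Sum>a<n. cnj (v i) * (cnj (C $$ (a, i)) * A $$ (a, b)) * C $$ (b, j) * v j)"
    by (auto simp: index_conj[OF A C] sum_distrib_left sum_distrib_right mult.assoc intro!: sum.cong)
  also have "\<dots> = (\<Sum>i<m. \<Sum>b<n. \<Sum>a<n. \<Sum>j<m. cnj (v i) * (cnj (C $$ (a, i)) * A $$ (a, b)) * C $$ (b, j) * v j)"
    by (rule sum.cong[OF refl], subst sum.swap, rule sum.cong[OF refl], rule sum.swap)
  also have "\<dots> = (\<Sum>b<n. \<Sum>a<n. \<Sum>i<m. \<Sum>j<m. cnj (v i) * (cnj (C $$ (a, i)) * A $$ (a, b)) * C $$ (b, j) * v j)"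
    by (subst sum.swap, rule sum.cong[OF refl], rule sum.swap)
  also have "\<dots> = (\<Sum>b<n. \<Sum>a<n. cnj (w a) * A $$ (a, b) * w b)"
    by (auto simp: w_def sum_distrib_left sum_distrib_right mult_ac intro!: sum.cong)
  also have "\<dots> = (\<Sum>a<n. \<Sum>b<n. cnj (w a) * A $$ (a, b) * w b)"
    by (rule sum.swap)
  finally show "0 \<le> (\<Sum>i<m. \<Sum>j<m. cnj (v i) * (adj C * A * C) $$ (i, j) * v j)"
    using assms(1) by (simp add: psd_alt)
qed

lemma psd_diag_nonneg:
  assumes "psd n A" "k < n"
  shows "0 \<le> A $$ (k, k)"
proof -
  have "0 \<le> (\<Sum>a<n. \<Sum>b<n. cnj (v a) * A $$ (a, b) * v b)" for v
    using assms(1) by (simp add: psd_alt)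
  from this[of "\<lambda>a. of_bool (a = k)"] assms(2) show ?thesis
    by (simp add: mult.assoc flip: sum_distrib_left)
qed

definition diagm :: "nat \<Rightarrow> (nat \<Rightarrow> complex) \<Rightarrow> complex mat" where
  "diagm n f = mat n n (\<lambda>(i, j). if i = j then f i else 0)"

lemma diagm_carrier [simp]: "diagm n f \<in> carrier_mat n n"
  by (simp add: diagm_def)

lemma dim_diagm [simp]: "dim_row (diagm n f) = n" "dim_col (diagm n f) = n"
  by (simp_all add: diagm_def)

lemma diagm_one: "diagm n (\<lambda>_. 1) = 1\<^sub>m n"
  by (simp add: diagm_def one_mat_def)

lemma psd_diagm:
  assumes "\<And>i. i < n \<Longrightarrow> 0 \<le> f i"
  shows "psd n (diagm n f)"
  unfolding psd_alt
proof (intro conjI allI)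
  fix v
  have "(\<Sum>i<n. \<Sum>j<n. cnj (v i) * diagm n f $$ (i, j) * v j)
    = (\<Sum>i<n. f i * (v i * cnj (v i)))"
    by (auto simp: diagm_def if_distrib if_distribR sum.delta' mult_ac intro!: sum.cong cong: if_cong)
  also have "\<dots> \<ge> 0"
  proof (rule sum_nonneg)
    fix i assume "i \<in> {..<n}"
    then have "0 \<le> f i" using assms by simp
    moreover have "0 \<le> v i * cnj (v i)" by (simp add: less_eq_complex_def)
    ultimately show "0 \<le> f i * (v i * cnj (v i))" by (rule mult_nonneg_nonneg)
  qed
  finally show "0 \<le> (\<Sum>i<n. \<Sum>j<n. cnj (v i) * diagm n f $$ (i, j) * v j)" .
qed simp

lemma psd_one [simp]: "psd n (1\<^sub>m n)"
  unfolding diagm_one[symmetric] by (rule psd_diagm) (simp add: less_eq_complex_def)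

lemma psd_gram:
  assumes "C \<in> carrier_mat n m"
  shows "psd m (adj C * C)"
  using psd_conj[OF psd_one assms] assms right_mult_one_mat[of "adj C" m n] by simp

lemma psd_msum:
  assumes "\<And>k. k \<in> I \<Longrightarrow> psd n (f k)"
  shows "psd n (msum n f I)"
  unfolding psd_alt
proof (intro conjI allI)
  fix v
  have "(\<Sum>i<n. \<Sum>j<n. cnj (v i) * msum n f I $$ (i, j) * v j)
      = (\<Sum>i<n. \<Sum>j<n. \<Sum>k\<in>I. cnj (v i) * f k $$ (i, j) * v j)"
    by (simp add: msum_def sum_distrib_left sum_distrib_right)
  also have "\<dots> = (\<Sum>k\<in>I. \<Sum>i<n. \<Sum>j<n. cnj (v i) * f k $$ (i, j) * v j)"
    by (subst (2) sum.swap, subst sum.swap, rule refl)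
  also have "\<dots> \<ge> 0"
    using assms unfolding psd_alt by (blast intro: sum_nonneg)
  finally show "0 \<le> (\<Sum>i<n. \<Sum>j<n. cnj (v i) * msum n f I $$ (i, j) * v j)" .
qed simp

subsection \<open>Spectral theorem and square roots\<close>

lemma cmod_sq: "z * cnj z = complex_of_real ((cmod z)\<^sup>2)"
  by (rule complex_norm_square[symmetric])

text \<open>The Householder reflection that exchanges \<open>v\<close> and the first basis vector; the sign of
  \<open>v 0\<close> keeps the denominator away from 0.\<close>

lemma householder:
  assumes n: "0 < n" and v: "(\<Sum>i<n. v i * cnj (v i)) = 1"
    and v0: "v 0 = - complex_of_real t" and t: "0 \<le> t"
  obtains U where "U \<in> carrier_mat n n" "adj U * U = 1\<^sub>m n" "\<forall>i<n. U $$ (i, 0) = v i"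
proof -
  define w where "w i = of_bool (i = 0) - v i" for i
  define c where "c = complex_of_real (1 + t)"
  have c0: "c \<noteq> 0" unfolding c_def using t by (subst of_real_eq_0_iff) simp
  have cc: "cnj c = c" by (simp add: c_def)
  have w0: "w 0 = c" by (simp add: w_def v0 c_def)
  \<comment> \<open>The squared norm of \<open>w\<close> is 2 - 2 Re (\<open>v 0\<close>) = 2 (1 +
    \<open>t\<close>), so the usual reflection factor 2 divided by it is the inverse of
    \<open>c\<close>. As \<open>v 0\<close> is real, \<open>cnj (w 0)\<close> cancels against that
    factor and the first column becomes \<open>v\<close>.\<close>
  have ww: "(\<Sum>i<n. cnj (w i) * w i) = 2 * c"
  proof -
    have "(\<Sum>i<n. cnj (w i) * w i)
        = (\<Sum>i<n. v i * cnj (v i) + of_bool (i = 0) * (1 - v i - cnj (v i)))"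
      by (intro sum.cong refl) (auto simp: w_def algebra_simps)
    also have "\<dots> = 2 * c"
      using n by (simp add: sum.distrib v v0 c_def)
    finally show ?thesis .
  qed
  define e where "e = inverse c"
  have ce: "c * e = 1" and ce': "cnj e = e" using c0 cc by (auto simp: e_def)
  define U where "U = mat n n (\<lambda>(i, j). of_bool (i = j) - w i * cnj (w j) * e)"
  have U: "U \<in> carrier_mat n n" by (simp add: U_def)
  have "adj U * U = 1\<^sub>m n"
  proof (rule eq_matI)
    fix i j assume "i < dim_row (1\<^sub>m n :: complex mat)" "j < dim_col (1\<^sub>m n :: complex mat)"
    then have ij: "i < n" "j < n" by auto
    have Uki: "adj U $$ (i, k) = of_bool (k = i) - cnj (w k) * w i * e" if "k < n" for k
      using that ij by (simp add: U_def ce')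
    have Ukj: "U $$ (k, j) = of_bool (k = j) - w k * cnj (w j) * e" if "k < n" for k
      using that ij by (simp add: U_def)
    have "(adj U * U) $$ (i, j)
        = (\<Sum>k<n. (of_bool (k = i) - cnj (w k) * w i * e) * (of_bool (k = j) - w k * cnj (w j) * e))"
      using Uki Ukj by (simp add: index_mult[OF adj_carrier[OF U] U ij])
    also have "\<dots> = (\<Sum>k<n. of_bool (k = i) * (of_bool (k = j) - w k * cnj (w j) * e)
                  - of_bool (k = j) * (cnj (w k) * w i * e)
                  + (cnj (w k) * w k) * (w i * cnj (w j) * (e * e)))"
      by (rule sum.cong[OF refl]) (simp add: algebra_simps)
    also have "\<dots> = (of_bool (i = j) - w i * cnj (w j) * e) - cnj (w j) * w i * e
                  + (2 * c) * (w i * cnj (w j) * (e * e))"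
      unfolding sum.distrib sum_subtractf sum_distrib_right[symmetric] ww using ij by simp
    also have "(2 * c) * (w i * cnj (w j) * (e * e)) = 2 * (w i * cnj (w j) * e) * (c * e)"
      by (simp add: mult_ac)
    also have "(of_bool (i = j) - w i * cnj (w j) * e) - cnj (w j) * w i * e + \<dots> = of_bool (i = j)"
      by (simp add: ce algebra_simps)
    finally show "(adj U * U) $$ (i, j) = 1\<^sub>m n $$ (i, j)" using ij by simp
  qed (use U in auto)
  moreover have "U $$ (i, 0) = v i" if "i < n" for i
  proof -
    have "U $$ (i, 0) = of_bool (i = 0) - w i * (c * e)"
      using that n by (simp add: U_def w0 cc)
    then show ?thesis by (simp add: ce) (simp add: w_def)
  qed
  ultimately show ?thesis using U that by blast
qed

text \<open>Brings an eigenvector into the shape that \<open>householder\<close> expects: unit norm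
  and a first coordinate that is real and not positive.\<close>

lemma unit_eigenvector:
  fixes A :: "complex mat"
  assumes A: "A \<in> carrier_mat n n" and n: "0 < n"
  obtains v \<mu> t where "(\<Sum>i<n. v i * cnj (v i)) = 1" "v 0 = - complex_of_real t" "0 \<le> t"
    "\<forall>i<n. (\<Sum>k<n. A $$ (i, k) * v k) = \<mu> * v i"
proof -
  obtain \<mu> where "eigenvalue A \<mu>"
    using spectrum_non_empty[OF A n] by (auto simp: spectrum_def)
  then obtain u where u: "u \<in> carrier_vec n" "u \<noteq> 0\<^sub>v n" "A *\<^sub>v u = \<mu> \<cdot>\<^sub>v u"
    using A by (auto simp: eigenvalue_def eigenvector_def)
  define N where "N = sqrt (\<Sum>i<n. (cmod (u $ i))\<^sup>2)"
  have "\<exists>i<n. u $ i \<noteq> 0"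
    using u(1,2) by (metis carrier_vecD eq_vecI index_zero_vec)
  then have "0 < (\<Sum>i<n. (cmod (u $ i))\<^sup>2)"
    by (auto intro!: sum_pos2)
  then have N: "0 < N" "N\<^sup>2 = (\<Sum>i<n. (cmod (u $ i))\<^sup>2)"
    by (auto simp: N_def sum_nonneg)
  \<comment> \<open>A phase that rotates the first coordinate to minus its modulus. If that
    coordinate vanishes, any phase serves and \<open>t\<close> is 0.\<close>
  define z where "z = (if u $ 0 = 0 then 1 else - cnj (sgn (u $ 0)))"
  have z: "cmod z = 1" by (auto simp: z_def norm_sgn)
  define v where "v i = z * u $ i / of_real N" for i
  have "(\<Sum>i<n. v i * cnj (v i)) = (\<Sum>i<n. of_real ((cmod (u $ i))\<^sup>2 / N\<^sup>2))"
    by (intro sum.cong refl, unfold cmod_sq) (use N z in \<open>simp add: v_def norm_mult norm_divide power_divide\<close>)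
  also have "\<dots> = of_real ((\<Sum>i<n. (cmod (u $ i))\<^sup>2) / N\<^sup>2)"
    unfolding sum_divide_distrib of_real_sum ..
  also have "\<dots> = 1"
    using N(1) by (simp flip: N(2))
  finally have 1: "(\<Sum>i<n. v i * cnj (v i)) = 1" .
  have 2: "v 0 = - complex_of_real (cmod (u $ 0) / N)"
  proof (cases "u $ 0 = 0")
    case False
    have "cnj (sgn (u $ 0)) * u $ 0 = of_real (cmod (u $ 0))"
      using False
      by (simp add: sgn_eq field_simps) (simp add: cmod_sq power2_eq_square)
    then show ?thesis using False by (simp add: v_def z_def)
  qed (simp add: v_def)
  have 3: "(\<Sum>k<n. A $$ (i, k) * v k) = \<mu> * v i" if i: "i < n" for i
  proof -
    have "(\<Sum>k<n. A $$ (i, k) * v k) = (\<Sum>k<n. A $$ (i, k) * u $ k) * (z / of_real N)"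
      by (simp add: v_def sum_distrib_left sum_distrib_right sum_divide_distrib mult_ac)
    also have "(\<Sum>k<n. A $$ (i, k) * u $ k) = (A *\<^sub>v u) $ i"
      using A u(1) i by (auto simp: scalar_prod_def lessThan_atLeast0 intro!: sum.cong)
    also have "\<dots> = \<mu> * u $ i" using u i by simp
    finally show ?thesis by (simp add: v_def)
  qed
  show ?thesis by (rule that[OF 1 2]) (use 3 N(1) in auto)
qed

text \<open>Deflation: after reflecting the first basis vector to an eigenvector, the first column
  of the conjugated matrix is \<mu> times that basis vector. Hermiticity clears the first row as
  well, and the remaining block is hermitian of size \<open>n\<close>. The diagonal is left complex
  here; for positive matrices it is made real in \<open>psd_spectral\<close>.\<close>

theorem hermitian_diagonalization:
  assumes "A \<in> carrier_mat n n" "adj A = A"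
  shows "\<exists>U f. U \<in> carrier_mat n n \<and> adj U * U = 1\<^sub>m n \<and> A = U * diagm n f * adj U"
  using assms
proof (induction n arbitrary: A)
  case 0
  then show ?case by (intro exI[of _ "1\<^sub>m 0"]) (auto intro!: eq_matI)
next
  case (Suc n)
  let ?n = "Suc n"
  note A = Suc.prems(1)
  obtain v \<mu> t where v: "(\<Sum>i<?n. v i * cnj (v i)) = 1" "v 0 = - complex_of_real t" "0 \<le> t"
    and ev: "\<forall>i<?n. (\<Sum>k<?n. A $$ (i, k) * v k) = \<mu> * v i"
    by (rule unit_eigenvector[OF A zero_less_Suc], rule that)
  obtain H where H: "H \<in> carrier_mat ?n ?n" "adj H * H = 1\<^sub>m ?n" "\<forall>i<?n. H $$ (i, 0) = v i"
    by (rule householder[OF zero_less_Suc v], rule that)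
  note aH = adj_carrier[OF H(1)]
  have HH: "H * adj H = 1\<^sub>m ?n"
    using mat_mult_left_right_inverse[OF aH H(1) H(2)] .
  define Y where "Y = adj H * A * H"
  have Y: "Y \<in> carrier_mat ?n ?n" using A H(1) by (auto simp: Y_def)
  have Yh: "adj Y = Y"
    unfolding Y_def adj_mult[OF mult_carrier_mat[OF aH A] H(1)] adj_mult[OF aH A] adj_adj Suc.prems(2)
    by (rule assoc_mult_mat[OF aH A H(1), symmetric])
  have Y0: "Y $$ (i, 0) = (if i = 0 then \<mu> else 0)" if i: "i < ?n" for i
  proof -
    have AH: "(A * H) $$ (k, 0) = \<mu> * H $$ (k, 0)" if "k < ?n" for k
      using that ev H(3) by (simp add: index_mult[OF A H(1)] del: sum.lessThan_Suc)
    have "Y = adj H * (A * H)" unfolding Y_def by (rule assoc_mult_mat[OF aH A H(1)])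
    then have "Y $$ (i, 0) = (\<Sum>k<?n. adj H $$ (i, k) * (\<mu> * H $$ (k, 0)))"
      using i A H(1) AH by (subst index_mult[OF aH mult_carrier_mat[OF A H(1)]] | simp del: sum.lessThan_Suc)+
    also have "\<dots> = \<mu> * (adj H * H) $$ (i, 0)"
      using i by (simp add: index_mult[OF aH H(1)] sum_distrib_left mult_ac del: sum.lessThan_Suc)
    finally show ?thesis using i H(2) by simp
  qed
  have Y0': "Y $$ (0, i) = (if i = 0 then \<mu> else 0)" if i: "i < ?n" for i
  proof -
    have "Y $$ (0, i) = cnj (Y $$ (i, 0))"
      using i Y index_adj[of 0 Y i] unfolding Yh by simp
    then show ?thesis using Y0[OF i] by (cases "i = 0") (simp_all add: Y0)
  qed
  define B where "B = mat n n (\<lambda>(i, j). Y $$ (Suc i, Suc j))"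
  have B: "B \<in> carrier_mat n n" by (simp add: B_def)
  have "adj B = B"
  proof (rule eq_matI)
    fix i j assume "i < dim_row B" "j < dim_col B"
    then have ij: "i < n" "j < n" using B by auto
    have "adj Y $$ (Suc i, Suc j) = cnj (Y $$ (Suc j, Suc i))" using ij Y by simp
    then show "adj B $$ (i, j) = B $$ (i, j)" using ij by (simp add: B_def Yh)
  qed (use B in auto)
  from Suc.IH[OF B this] obtain V f where V: "V \<in> carrier_mat n n" "adj V * V = 1\<^sub>m n"
    and Bf: "B = V * diagm n f * adj V" by blast
  note aV = adj_carrier[OF V(1)]
  let ?blk = "\<lambda>a X. four_block_mat (mat 1 1 (\<lambda>_. a)) (0\<^sub>m 1 n) (0\<^sub>m n 1) X"
  have blk_mult: "?blk a X * ?blk b Z = ?blk (a * b) (X * Z)"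
    if "X \<in> carrier_mat n n" "Z \<in> carrier_mat n n" for a b :: complex and X Z
    using that by (subst mult_four_block_mat[of _ 1 1 _ n _ n _ _ 1 _ n])
      (auto intro!: cong_four_block_mat eq_matI simp: index_mult_mat(1) scalar_prod_def)
  have blk_carrier: "?blk a X \<in> carrier_mat ?n ?n" if "X \<in> carrier_mat n n" for a :: complex and X
    using four_block_carrier_mat[of "mat 1 1 (\<lambda>_. a)" 1 1 X n n] that by simp
  have adj_blk: "adj (?blk 1 V) = ?blk 1 (adj V)"
    using V(1) by (auto intro!: eq_matI)
  define g where "g i = (case i of 0 \<Rightarrow> \<mu> | Suc j \<Rightarrow> f j)" for i
  have diag: "diagm ?n g = ?blk \<mu> (diagm n f)"
    by (rule eq_matI) (auto simp: diagm_def g_def split: nat.split)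
  have one: "1\<^sub>m ?n = ?blk 1 (1\<^sub>m n)"
    by (rule eq_matI) auto
  have Yblk: "Y = ?blk \<mu> B"
  proof (rule eq_matI)
    fix i j assume "i < dim_row (?blk \<mu> B)" "j < dim_col (?blk \<mu> B)"
    then have "i < ?n" "j < ?n" using B by auto
    then show "Y $$ (i, j) = ?blk \<mu> B $$ (i, j)"
      using Y0[of i] Y0'[of j] B by (cases i; cases j) (auto simp: B_def)
  qed (use Y B in auto)
  \<comment> \<open>\<open>W\<close> diagonalizes the deflated matrix \<open>Y\<close>, fixing the
    first coordinate; then \<open>H * W\<close> diagonalizes \<open>A\<close>.\<close>
  define W where "W = ?blk 1 V"
  have W: "W \<in> carrier_mat ?n ?n" using blk_carrier[OF V(1)] by (simp add: W_def)
  have WW: "adj W * W = 1\<^sub>m ?n"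
    unfolding W_def adj_blk one blk_mult[OF aV V(1)] V(2) by simp
  have YW: "Y = W * diagm ?n g * adj W"
    unfolding W_def adj_blk diag Yblk Bf blk_mult[OF V(1) diagm_carrier]
      blk_mult[OF mult_carrier_mat[OF V(1) diagm_carrier] aV] by simp
  note aW = adj_carrier[OF W]
  note ac = assoc_mult_mat[of _ ?n ?n _ ?n _ ?n] mult_carrier_mat[of _ ?n ?n _ ?n] left_mult_one_mat[of _ ?n ?n] right_mult_one_mat[of _ ?n ?n]
  have HW: "H * W \<in> carrier_mat ?n ?n" using H(1) W by auto
  have "adj (H * W) * (H * W) = adj W * (adj H * H) * W"
    using H(1) W aH aW by (simp add: adj_mult[OF H(1) W] ac del: H)
  then have "adj (H * W) * (H * W) = 1\<^sub>m ?n"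
    using W aW WW H(2) by (simp add: ac)
  moreover have "A = (H * W) * diagm ?n g * adj (H * W)"
  proof -
    have "(H * W) * diagm ?n g * adj (H * W) = H * Y * adj H"
      using H(1) W aH aW by (simp add: adj_mult[OF H(1) W] YW ac)
    also have "\<dots> = (H * adj H) * A * (H * adj H)"
      using H(1) aH A by (simp add: Y_def ac)
    also have "\<dots> = A" using HH A by simp
    finally show ?thesis by simp
  qed
  ultimately show ?case using HW by blast
qed

section \<open>Functional calculus in a fixed eigenbasis\<close>

lemma index_diagm_mult:
  assumes "A \<in> carrier_mat n n" "i < n" "j < n"
  shows "(diagm n f * A) $$ (i, j) = f i * A $$ (i, j)" "(A * diagm n f) $$ (i, j) = A $$ (i, j) * f j"
  using assms
  by (simp_all add: index_mult[of _ n n _ n] diagm_def if_distrib if_distribR sum.delta sum.delta' cong: if_cong)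

lemma diagm_mult: "diagm n f * diagm n g = diagm n (\<lambda>i. f i * g i)"
proof (rule eq_matI)
  fix i j assume "i < dim_row (diagm n (\<lambda>i. f i * g i))" "j < dim_col (diagm n (\<lambda>i. f i * g i))"
  then have ij: "i < n" "j < n" by (auto simp: diagm_def)
  then show "(diagm n f * diagm n g) $$ (i, j) = diagm n (\<lambda>i. f i * g i) $$ (i, j)"
    by (simp only: index_diagm_mult[OF diagm_carrier ij]) (simp add: diagm_def)
qed (auto simp: diagm_def)

definition unitary :: "nat \<Rightarrow> complex mat \<Rightarrow> bool" where
  "unitary n U \<longleftrightarrow> U \<in> carrier_mat n n \<and> adj U * U = 1\<^sub>m n \<and> U * adj U = 1\<^sub>m n"

text \<open>Functions of one operator share \<open>U\<close> and differ only in \<open>f\<close>, so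
  roots, pseudo-inverses and their products reduce to pointwise arithmetic on the spectrum.\<close>

definition spec :: "nat \<Rightarrow> complex mat \<Rightarrow> (nat \<Rightarrow> real) \<Rightarrow> complex mat" where
  "spec n U f = U * diagm n (\<lambda>i. complex_of_real (f i)) * adj U"

lemma unitaryD:
  assumes "unitary n U"
  shows "U \<in> carrier_mat n n" "adj U \<in> carrier_mat n n" "adj U * U = 1\<^sub>m n" "U * adj U = 1\<^sub>m n"
  using assms by (auto simp: unitary_def)

lemma unitary_adj: "unitary n U \<Longrightarrow> unitary n (adj U)"
  by (auto simp: unitary_def)

lemma unitary_cancel:
  assumes "unitary n U" "A \<in> carrier_mat n m"
  shows "adj U * (U * A) = A" "U * (adj U * A) = A"
  using unitaryD[OF assms(1)] assms(2)
  by (simp_all add: assoc_mult_mat[of _ n n _ n _ m, symmetric])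

lemma unitary_mult:
  assumes U: "unitary n U" and V: "unitary n V"
  shows "unitary n (U * V)"
proof -
  note u = unitaryD[OF U] and v = unitaryD[OF V]
  have "adj (U * V) * (U * V) = 1\<^sub>m n"
    unfolding adj_mult[OF u(1) v(1)] assoc_mult_mat[OF v(2) u(2) mult_carrier_mat[OF u(1) v(1)]]
      unitary_cancel[OF U v(1)] by (rule v(3))
  moreover have "U * V * adj (U * V) = 1\<^sub>m n"
    unfolding adj_mult[OF u(1) v(1)] assoc_mult_mat[OF u(1) v(1) mult_carrier_mat[OF v(2) u(2)]]
      unitary_cancel[OF V u(2)] by (rule u(4))
  ultimately show ?thesis using mult_carrier_mat[OF u(1) v(1)] by (simp add: unitary_def)
qed

lemma mtrace_unitary_conj:
  assumes U: "unitary n U" and A: "A \<in> carrier_mat n n"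
  shows "mtrace (adj U * A * U) = mtrace A"
proof -
  note u = unitaryD[OF U]
  have "mtrace (adj U * A * U) = mtrace (U * (adj U * A))"
    using u A by (intro mtrace_comm[of _ n n]) auto
  then show ?thesis by (simp add: unitary_cancel[OF U A])
qed

lemma spec_carrier [simp]: "unitary n U \<Longrightarrow> spec n U f \<in> carrier_mat n n"
  unfolding spec_def by (intro mult_carrier_mat[of _ n n] unitaryD diagm_carrier)

lemma spec_cong: "(\<And>i. i < n \<Longrightarrow> f i = g i) \<Longrightarrow> spec n U f = spec n U g"
  unfolding spec_def by (intro arg_cong[of _ _ "\<lambda>D. U * D * adj U"] eq_matI) (auto simp: diagm_def)

lemma spec_one:
  assumes "unitary n U"
  shows "spec n U (\<lambda>_. 1) = 1\<^sub>m n"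
  using unitaryD[OF assms] by (simp add: spec_def diagm_one right_mult_one_mat[of _ n n])

lemma spec_conj:
  assumes U: "unitary n U" and C: "C \<in> carrier_mat n n"
  shows "adj C * spec n U f * C = spec n (adj C * U) f"
proof -
  note u = unitaryD[OF U] and aC = adj_carrier[OF C]
  have CU: "adj (adj C * U) = adj U * C" by (simp add: adj_mult[OF aC u(1)])
  show ?thesis
    unfolding spec_def CU using u C aC
    by (simp add: assoc_mult_mat[of _ n n _ n _ n] mult_carrier_mat[of _ n n _ n] left_mult_one_mat[of _ n n] right_mult_one_mat[of _ n n])
qed

lemma spec_conj_self:
  assumes U: "unitary n U"
  shows "adj U * spec n U f * U = diagm n (\<lambda>i. complex_of_real (f i))"
proof -
  note u = unitaryD[OF U]
  show ?thesis
    unfolding spec_def using u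
    by (simp add: assoc_mult_mat[of _ n n _ n _ n] mult_carrier_mat[of _ n n _ n] right_mult_one_mat[of _ n n]
        unitary_cancel[OF U, of _ n])
qed

lemma spec_mult:
  assumes U: "unitary n U"
  shows "spec n U f * spec n U g = spec n U (\<lambda>i. f i * g i)"
proof -
  note u = unitaryD[OF U]
  have "spec n U f * spec n U g
      = U * (diagm n (\<lambda>i. complex_of_real (f i)) * diagm n (\<lambda>i. complex_of_real (g i))) * adj U"
    using u by (simp add: spec_def assoc_mult_mat[of _ n n _ n _ n] mult_carrier_mat[of _ n n _ n] left_mult_one_mat[of _ n n] right_mult_one_mat[of _ n n]
        unitary_cancel[OF U, of _ n])
  then show ?thesis by (simp add: diagm_mult spec_def)
qed

lemma spec_diff:
  assumes U: "unitary n U"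
  shows "spec n U f - spec n U g = spec n U (\<lambda>i. f i - g i)"
proof -
  note u = unitaryD[OF U]
  let ?F = "diagm n (\<lambda>i. complex_of_real (f i))" and ?G = "diagm n (\<lambda>i. complex_of_real (g i))"
  have "spec n U (\<lambda>i. f i - g i) = U * (?F - ?G) * adj U"
    by (simp add: spec_def, rule arg_cong[of _ _ "\<lambda>D. U * D * adj U"], rule eq_matI) (auto simp: diagm_def)
  also have "\<dots> = (U * ?F - U * ?G) * adj U"
    using u by (subst mult_minus_distrib_mat[of _ n n _ n]) auto
  also have "\<dots> = spec n U f - spec n U g"
    unfolding spec_def using u by (subst minus_mult_distrib_mat[of _ n n _ _ n]) auto
  finally show ?thesis ..
qed

text \<open>For unitary \<open>U\<close> the weights in each row sum to 1, so the diagonal entries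
  are means of the spectrum. This is what lets a scalar convexity argument speak about matrices that
  do not commute.\<close>

lemma spec_diag_entry:
  assumes U: "U \<in> carrier_mat n n" and i: "i < n"
  shows "spec n U f $$ (i, i) = complex_of_real (\<Sum>j<n. f j * (cmod (U $$ (i, j)))\<^sup>2)"
proof -
  have UD: "U * diagm n (\<lambda>i. complex_of_real (f i)) \<in> carrier_mat n n" using U by auto
  have "spec n U f $$ (i, i) = (\<Sum>j<n. U $$ (i, j) * complex_of_real (f j) * cnj (U $$ (i, j)))"
    using U i by (simp add: spec_def index_mult[OF UD adj_carrier[OF U]] index_diagm_mult)
  also have "\<dots> = (\<Sum>j<n. complex_of_real (f j * (cmod (U $$ (i, j)))\<^sup>2))"
    by (intro sum.cong refl) (simp add: mult_ac cmod_sq[symmetric] del: of_real_power)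
  finally show ?thesis by simp
qed

lemma psd_spec:
  assumes U: "unitary n U" and f: "\<And>i. i < n \<Longrightarrow> 0 \<le> f i"
  shows "psd n (spec n U f)"
proof -
  have "psd n (diagm n (\<lambda>i. complex_of_real (f i)))"
    using f by (intro psd_diagm) (auto simp: less_eq_complex_def)
  from psd_conj[OF this unitaryD(2)[OF U]] show ?thesis by (simp add: spec_def)
qed

text \<open>The diagonal obtained from \<open>hermitian_diagonalization\<close> is that of
  \<open>adj U * A * U\<close>, which is again positive semidefinite. Its entries are therefore
  nonnegative reals, and taking real parts changes nothing.\<close>

lemma psd_spectral:
  assumes "psd n A"
  obtains U f where "unitary n U" "\<forall>i<n. 0 \<le> f i" "A = spec n U f"
proof -
  have A: "A \<in> carrier_mat n n" using assms by (rule psd_carrier)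
  obtain U f where U: "U \<in> carrier_mat n n" "adj U * U = 1\<^sub>m n" and Af: "A = U * diagm n f * adj U"
    using hermitian_diagonalization[OF A psd_hermitian[OF assms]] by blast
  have un: "unitary n U"
    using U mat_mult_left_right_inverse[OF adj_carrier[OF U(1)] U(1)] by (simp add: unitary_def)
  note u = unitaryD[OF un]
  have "adj U * A * U = diagm n f"
    unfolding Af using u
    by (simp add: assoc_mult_mat[of _ n n _ n _ n] mult_carrier_mat[of _ n n _ n] left_mult_one_mat[of _ n n] right_mult_one_mat[of _ n n] unitary_cancel[OF un, of _ n])
  then have "psd n (diagm n f)" using psd_conj[OF assms U(1)] by simp
  then have f: "0 \<le> f i" if "i < n" for i
    using psd_diag_nonneg[of n "diagm n f" i] that by (simp add: diagm_def)
  then have "diagm n f = diagm n (\<lambda>i. complex_of_real (Re (f i)))"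
    by (intro eq_matI) (auto simp: diagm_def complex_eq_iff less_eq_complex_def)
  then show ?thesis
    using that[OF un, of "\<lambda>i. Re (f i)"] f Af by (simp add: spec_def less_eq_complex_def)
qed

text \<open>With \<open>W = adj U * V\<close>, equality of the squares says that \<open>W\<close>
  intertwines the squared spectra: at each entry either \<open>W\<close> vanishes or
  \<open>f i * f i = g j * g j\<close>. Nonnegativity removes the squares, so \<open>W\<close>
  intertwines the spectra themselves. This is what justifies the definite description in
  \<open>msqrt\<close>.\<close>

lemma psd_sqrt_unique:
  assumes "psd n S" "psd n T" and eq: "S * S = T * T"
  shows "S = T"
proof -
  obtain U f where U: "unitary n U" and f: "\<forall>i<n. 0 \<le> f i" and S: "S = spec n U f"
    by (rule psd_spectral[OF assms(1)])
  obtain V g where V: "unitary n V" and g: "\<forall>i<n. 0 \<le> g i" and T: "T = spec n V g"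
    by (rule psd_spectral[OF assms(2)])
  note u = unitaryD[OF U] and v = unitaryD[OF V]
  note ac = assoc_mult_mat[of _ n n _ n _ n] mult_carrier_mat[of _ n n _ n] left_mult_one_mat[of _ n n] right_mult_one_mat[of _ n n]
  define W where "W = adj U * V"
  have W: "W \<in> carrier_mat n n" using u v by (auto simp: W_def)
  let ?D = "\<lambda>f. diagm n (\<lambda>i. complex_of_real (f i))"
  have SW: "spec n U h * V = U * (?D h * W)" for h
    using u v by (simp add: spec_def W_def ac)
  have TW: "spec n V h * V = U * (W * ?D h)" for h
    using u v by (simp add: spec_def W_def ac unitary_cancel[OF U, of _ n])
  have "?D (\<lambda>i. f i * f i) * W = adj U * (spec n U (\<lambda>i. f i * f i) * V)"
    unfolding SW by (rule unitary_cancel(1)[OF U mult_carrier_mat[OF diagm_carrier W], symmetric])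
  also have "spec n U (\<lambda>i. f i * f i) = spec n V (\<lambda>i. g i * g i)"
    using eq by (simp add: S T spec_mult U V)
  also have "adj U * (spec n V (\<lambda>i. g i * g i) * V) = W * ?D (\<lambda>i. g i * g i)"
    unfolding TW by (rule unitary_cancel(1)[OF U mult_carrier_mat[OF W diagm_carrier]])
  finally have DW: "?D (\<lambda>i. f i * f i) * W = W * ?D (\<lambda>i. g i * g i)" .
  have "?D f * W = W * ?D g"
  proof (rule eq_matI)
    fix i j assume "i < dim_row (W * ?D g)" "j < dim_col (W * ?D g)"
    then have ij: "i < n" "j < n" using W by (auto simp: diagm_def)
    have "complex_of_real (f i * f i) * W $$ (i, j) = W $$ (i, j) * complex_of_real (g j * g j)"
      using arg_cong[OF DW, of "\<lambda>A. A $$ (i, j)"] by (simp add: index_diagm_mult[OF W ij])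
    then have "W $$ (i, j) = 0 \<or> complex_of_real (f i * f i) = complex_of_real (g j * g j)"
      by (simp add: mult.commute)
    then have "W $$ (i, j) = 0 \<or> f i * f i = g j * g j"
      by (simp only: of_real_eq_iff)
    then have "W $$ (i, j) = 0 \<or> f i = g j"
      using f g ij by (metis power2_eq_imp_eq power2_eq_square)
    then show "(?D f * W) $$ (i, j) = (W * ?D g) $$ (i, j)"
      by (auto simp: index_diagm_mult[OF W ij])
  qed (use W in \<open>auto simp: diagm_def\<close>)
  then have "S * V = T * V" unfolding S T SW TW by simp
  then have "S * V * adj V = T * V * adj V" by simp
  then show ?thesis
    using psd_carrier[OF assms(1)] psd_carrier[OF assms(2)] v by (simp add: ac)
qed

lemma msqrt_eq:
  assumes "psd n S" "S * S = A"
  shows "msqrt A = S"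
  unfolding msqrt_def
proof (rule the_equality)
  have "dim_row A = n" using assms psd_carrier[OF assms(1)] by auto
  then show "psd (dim_row A) S \<and> S * S = A" using assms by simp
  fix T assume "psd (dim_row A) T \<and> T * T = A"
  then show "T = S" using psd_sqrt_unique[of n T S] assms \<open>dim_row A = n\<close> by simp
qed

lemma msqrt_spec:
  assumes "unitary n U" "\<And>i. i < n \<Longrightarrow> 0 \<le> f i"
  shows "msqrt (spec n U f) = spec n U (\<lambda>i. sqrt (f i))"
proof (rule msqrt_eq)
  show "psd n (spec n U (\<lambda>i. sqrt (f i)))" using assms by (intro psd_spec) auto
  have "spec n U (\<lambda>i. sqrt (f i) * sqrt (f i)) = spec n U f"
    using assms(2) by (intro spec_cong) simp
  then show "spec n U (\<lambda>i. sqrt (f i)) * spec n U (\<lambda>i. sqrt (f i)) = spec n U f"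
    by (simp add: spec_mult[OF assms(1)])
qed

lemma psd_msqrt:
  assumes "psd n A"
  shows "psd n (msqrt A)" "msqrt A * msqrt A = A"
proof -
  obtain U f where U: "unitary n U" and f: "\<forall>i<n. 0 \<le> f i" and A: "A = spec n U f"
    by (rule psd_spectral[OF assms])
  have "msqrt A = spec n U (\<lambda>i. sqrt (f i))" using msqrt_spec[OF U] f A by simp
  moreover have S: "psd n (spec n U (\<lambda>i. sqrt (f i)))" using f by (intro psd_spec[OF U]) auto
  moreover have "spec n U (\<lambda>i. sqrt (f i)) * spec n U (\<lambda>i. sqrt (f i)) = A"
    unfolding A spec_mult[OF U] using f by (intro spec_cong) simp
  ultimately show "psd n (msqrt A)" "msqrt A * msqrt A = A" by auto
qed

text \<open>By cyclicity the trace is that of \<open>S * B * S\<close> with \<open>S\<close> the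
  root of \<open>A\<close>, a positive semidefinite matrix.\<close>

lemma mtrace_mult_nonneg:
  assumes A: "psd n A" and B: "psd n B"
  shows "0 \<le> Re (mtrace (A * B))"
proof -
  define S where "S = msqrt A"
  have S: "psd n S" "S * S = A" using psd_msqrt[OF A] by (auto simp: S_def)
  note c = psd_carrier[OF S(1)] psd_carrier[OF B]
  have "mtrace (A * B) = mtrace (S * (S * B))"
    using c by (simp flip: S(2))
  also have "\<dots> = mtrace (adj S * B * S)"
    using c by (subst mtrace_comm[of _ n n]) (auto simp: psd_hermitian[OF S(1)])
  finally have eq: "mtrace (A * B) = mtrace (adj S * B * S)" .
  have "0 \<le> Re ((adj S * B * S) $$ (i, i))" if "i < n" for i
    using psd_diag_nonneg[OF psd_conj[OF B c(1)] that] by (simp add: less_eq_complex_def)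
  then show ?thesis using c unfolding eq unfolding mtrace_def by (auto intro!: sum_nonneg)
qed

text \<open>In an eigenbasis of \<open>adj X * X\<close> the columns of \<open>X\<close> have norms
  \<open>sqrt (f i)\<close>, and a diagonal entry is at most the norm of its column. The norms add
  up to the trace norm.\<close>

lemma Re_mtrace_le_trace_norm:
  assumes X: "X \<in> carrier_mat n n"
  shows "Re (mtrace X) \<le> trace_norm X"
proof -
  obtain U f where U: "unitary n U" and f: "\<forall>i<n. 0 \<le> f i" and XX: "adj X * X = spec n U f"
    by (rule psd_spectral[OF psd_gram[OF X]])
  note u = unitaryD[OF U] and aX = adj_carrier[OF X]
  define Y where "Y = adj U * X * U"
  have Y: "Y \<in> carrier_mat n n" using u X by (auto simp: Y_def)
  have YY: "adj Y * Y = diagm n (\<lambda>i. complex_of_real (f i))"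
  proof -
    have "adj Y = adj U * adj X * U"
      unfolding Y_def adj_mult[OF mult_carrier_mat[OF u(2) X] u(1)] adj_mult[OF u(2) X] adj_adj
      by (rule assoc_mult_mat[OF u(2) aX u(1), symmetric])
    then have "adj Y * Y = adj U * (adj X * X) * U"
      unfolding Y_def using u X aX
      by (simp add: assoc_mult_mat[of _ n n _ n _ n] mult_carrier_mat[of _ n n _ n] left_mult_one_mat[of _ n n] right_mult_one_mat[of _ n n] unitary_cancel[OF U, of _ n])
    then show ?thesis by (simp add: XX spec_conj_self[OF U])
  qed
  have le: "Re (Y $$ (i, i)) \<le> sqrt (f i)" if i: "i < n" for i
  proof -
    have "complex_of_real (f i) = (adj Y * Y) $$ (i, i)" using i by (simp add: YY diagm_def)
    also have "\<dots> = (\<Sum>k<n. complex_of_real ((cmod (Y $$ (k, i)))\<^sup>2))"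
      using Y i by (simp add: index_mult[OF adj_carrier[OF Y] Y i i] mult.commute cmod_sq[symmetric] del: of_real_power)
    finally have "f i = (\<Sum>k<n. (cmod (Y $$ (k, i)))\<^sup>2)" by (simp flip: of_real_sum del: of_real_power)
    then have "(cmod (Y $$ (i, i)))\<^sup>2 \<le> f i"
      using i member_le_sum[of i "{..<n}" "\<lambda>k. (cmod (Y $$ (k, i)))\<^sup>2"] by simp
    then show ?thesis using complex_Re_le_cmod[of "Y $$ (i, i)"] real_le_rsqrt by fastforce
  qed
  have "Re (mtrace X) = (\<Sum>i<n. Re (Y $$ (i, i)))"
    using Y unfolding mtrace_unitary_conj[OF U X, symmetric] Y_def[symmetric] by (simp add: mtrace_def)
  also have "\<dots> \<le> (\<Sum>i<n. sqrt (f i))" using le by (intro sum_mono) auto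
  also have "\<dots> = Re (mtrace (diagm n (\<lambda>i. complex_of_real (sqrt (f i)))))"
    by (simp add: mtrace_def diagm_def)
  also have "\<dots> = trace_norm X"
    using f unfolding trace_norm_def XX
    by (simp add: msqrt_spec[OF U] flip: mtrace_unitary_conj[OF U spec_carrier[OF U]] spec_conj_self[OF U])
  finally show ?thesis .
qed

subsection \<open>The square-root measurement\<close>

text \<open>Jensen's inequality for \<open>t \<mapsto> 1 / sqrt t\<close> in the linearized form
  \<open>1 / sqrt t \<ge> (3 - t) / 2\<close>, applied to \<open>t = l j / s\<close>; in Isabelle \<open>1 / sqrt 0 = 0\<close>,
  hence the hypothesis on the support.\<close>

lemma inverse_sqrt_mean_bound:
  fixes l p :: "nat \<Rightarrow> real"
  assumes p: "\<And>j. j < n \<Longrightarrow> 0 \<le> p j" "(\<Sum>j<n. p j) = 1"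
    and l: "\<And>j. j < n \<Longrightarrow> 0 \<le> l j" and supp: "\<And>j. j < n \<Longrightarrow> l j = 0 \<Longrightarrow> p j = 0"
    and s: "0 < s"
  shows "2 * s - (\<Sum>j<n. l j * p j) \<le> s\<^sup>2 * (\<Sum>j<n. 1 / sqrt (l j) * p j)\<^sup>2"
proof (cases "(\<Sum>j<n. l j * p j) < 2 * s")
  \<comment> \<open>Here \<open>3 - ?L / s\<close> is positive, so the linear bound may be squared.
    In the other case the left side of the claim is at most 0.\<close>
  case True
  let ?L = "\<Sum>j<n. l j * p j" and ?T = "\<Sum>j<n. 1 / sqrt (l j) * p j"
  \<comment> \<open>The tangent of 1 / sqrt \<open>t\<close> at 1, doubled. With
    \<open>t = u\<^sup>2\<close> the gap, multiplied by \<open>u\<close>, factors as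
    \<open>(u - 1)\<^sup>2 * (u + 2)\<close>.\<close>
  have tangent: "3 - t \<le> 2 / sqrt t" if "0 < t" for t :: real
  proof -
    define u where "u = sqrt t"
    have u: "0 < u" "t = u\<^sup>2" using that by (auto simp: u_def)
    have "0 \<le> (u - 1)\<^sup>2 * (u + 2)" using u by simp
    then have "(3 - t) * u \<le> 2" unfolding u(2) by (simp add: algebra_simps power2_eq_square)
    then show ?thesis using u by (simp add: pos_le_divide_eq flip: u_def)
  qed
  have "(3 - ?L / s) = (\<Sum>j<n. (3 - l j / s) * p j)"
    by (simp add: left_diff_distrib sum_subtractf p(2) sum_divide_distrib flip: sum_distrib_left)
  also have "\<dots> \<le> (\<Sum>j<n. 2 * sqrt s * (1 / sqrt (l j) * p j))"
  proof (rule sum_mono)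
    fix j assume "j \<in> {..<n}"
    then have j: "j < n" by simp
    show "(3 - l j / s) * p j \<le> 2 * sqrt s * (1 / sqrt (l j) * p j)"
    proof (cases "l j = 0")
      case False
      then have "0 < l j" using l[OF j] by simp
      then have "3 - l j / s \<le> 2 / sqrt (l j / s)" using s by (intro tangent) simp
      also have "\<dots> = 2 * sqrt s * (1 / sqrt (l j))" by (simp add: real_sqrt_divide)
      finally have "3 - l j / s \<le> 2 * sqrt s * (1 / sqrt (l j))" .
      from mult_right_mono[OF this p(1)[OF j]] show ?thesis by (simp add: mult.assoc)
    qed (use supp[OF j] in simp)
  qed
  also have "\<dots> = 2 * sqrt s * ?T" by (simp add: sum_distrib_left)
  finally have "3 - ?L / s \<le> 2 * sqrt s * ?T" .
  moreover have "0 \<le> 3 - ?L / s" using True s by (simp add: field_simps)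
  ultimately have "(3 - ?L / s)\<^sup>2 \<le> (2 * sqrt s * ?T)\<^sup>2" by (intro power_mono)
  also have "\<dots> = 4 * s * ?T\<^sup>2" using s by (simp add: power_mult_distrib)
  finally have "s * (3 - ?L / s)\<^sup>2 \<le> s * (4 * s * ?T\<^sup>2)" using s by (intro mult_left_mono) auto
  \<comment> \<open>With \<open>a = ?L / s\<close> the difference of the two sides is
    \<open>s\<close> times \<open>(3 - a)\<^sup>2 - 4 * (2 - a) = (1 - a)\<^sup>2\<close>.\<close>
  moreover have "4 * (2 * s - ?L) \<le> s * (3 - ?L / s)\<^sup>2"
  proof -
    have "s * (3 - ?L / s)\<^sup>2 - 4 * (2 * s - ?L) = s * (1 - ?L / s)\<^sup>2"
      using s by (simp add: power2_eq_square field_simps)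
    moreover have "0 \<le> s * (1 - ?L / s)\<^sup>2" using s by simp
    ultimately show ?thesis by linarith
  qed
  ultimately show ?thesis by (simp add: power2_eq_square)
next
  case False
  moreover have "0 \<le> s\<^sup>2 * (\<Sum>j<n. 1 / sqrt (l j) * p j)\<^sup>2" by simp
  ultimately show ?thesis by linarith
qed

lemma mtrace_spec_mult:
  assumes U: "unitary n U" and A: "A \<in> carrier_mat n n"
  shows "mtrace (spec n U f * A) = (\<Sum>i<n. complex_of_real (f i) * (adj U * A * U) $$ (i, i))"
proof -
  note u = unitaryD[OF U]
  let ?D = "diagm n (\<lambda>i. complex_of_real (f i))"
  have B: "adj U * A * U \<in> carrier_mat n n" using u A by auto
  have "mtrace (spec n U f * A) = mtrace (U * (?D * adj U * A))"
    using u A unfolding spec_def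
    by (simp add: assoc_mult_mat[of _ n n _ n _ n] mult_carrier_mat[of _ n n _ n])
  also have "\<dots> = mtrace (?D * adj U * A * U)"
    using u A by (intro mtrace_comm[of _ n n] mult_carrier_mat[of _ n n _ n] diagm_carrier)
  also have "?D * adj U * A * U = ?D * (adj U * A * U)"
    using u A by (simp add: assoc_mult_mat[of _ n n _ n _ n] mult_carrier_mat[of _ n n _ n])
  also have "mtrace \<dots> = (\<Sum>i<n. complex_of_real (f i) * (adj U * A * U) $$ (i, i))"
    using B by (simp add: mtrace_def index_diagm_mult[OF B])
  finally show ?thesis .
qed

text \<open>For nonnegative \<open>f\<close> and \<open>g\<close> every summand is nonnegative, so
  keeping only the diagonal \<open>i = j\<close> gives a lower bound on the trace.\<close>

lemma mtrace_spec_mult_spec: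
  assumes U: "unitary n U" and A: "A \<in> carrier_mat n n" "adj A = A"
  shows "mtrace (spec n U f * A * spec n U g * A)
    = complex_of_real (\<Sum>i<n. \<Sum>j<n. f i * g j * (cmod ((adj U * A * U) $$ (i, j)))\<^sup>2)"
proof -
  note u = unitaryD[OF U]
  note ac = assoc_mult_mat[of _ n n _ n _ n] mult_carrier_mat[of _ n n _ n]
  define B where "B = adj U * A * U"
  have B: "B \<in> carrier_mat n n" using u A by (auto simp: B_def)
  let ?D = "\<lambda>f. diagm n (\<lambda>i. complex_of_real (f i))"
  have "adj B = B"
    unfolding B_def adj_mult[OF mult_carrier_mat[OF u(2) A(1)] u(1)] adj_mult[OF u(2) A(1)] adj_adj A(2)
    by (rule assoc_mult_mat[OF u(2) A(1) u(1), symmetric])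
  then have Bji: "B $$ (j, i) = cnj (B $$ (i, j))" if "i < n" "j < n" for i j
    using index_adj[of j B i] that B by simp
  have "spec n U f * A * spec n U g * A = spec n U f * (A * spec n U g * A)"
    using U u A by (simp add: ac)
  then have "mtrace (spec n U f * A * spec n U g * A)
      = (\<Sum>i<n. complex_of_real (f i) * (adj U * (A * spec n U g * A) * U) $$ (i, i))"
    using U A by (simp add: mtrace_spec_mult mult_carrier_mat[of _ n n _ n])
  also have "adj U * (A * spec n U g * A) * U = B * (?D g * B)"
    using u A unfolding B_def spec_def by (simp add: ac)
  also have "(\<Sum>i<n. complex_of_real (f i) * (B * (?D g * B)) $$ (i, i))
      = (\<Sum>i<n. \<Sum>j<n. complex_of_real (f i * g j * (cmod (B $$ (i, j)))\<^sup>2))"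
  proof (intro sum.cong refl)
    fix i assume "i \<in> {..<n}"
    then have i: "i < n" by simp
    have "(B * (?D g * B)) $$ (i, i) = (\<Sum>j<n. complex_of_real (g j) * (B $$ (i, j) * cnj (B $$ (i, j))))"
      using i Bji[OF i]
      by (subst index_mult[OF B mult_carrier_mat[OF diagm_carrier B] i i])
        (simp add: index_diagm_mult[OF B] mult_ac)
    then show "complex_of_real (f i) * (B * (?D g * B)) $$ (i, i)
        = (\<Sum>j<n. complex_of_real (f i * g j * (cmod (B $$ (i, j)))\<^sup>2))"
      unfolding cmod_sq by (simp add: sum_distrib_left mult_ac)
  qed
  finally show ?thesis by (simp add: B_def)
qed

text \<open>Let \<open>s i\<close> be the eigenvalues of \<open>r x\<close>, and let \<tau> and
  \<kappa> be the diagonals of \<open>T\<close> and \<open>L\<close> in its eigenbasis. The success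
  term is at least the sum of \<open>(s i)^3 * (\<tau> i)\<^sup>2\<close>. By
  \<open>inverse_sqrt_mean_bound\<close>, each
  \<open>(s i)\<^sup>2 - (s i)^3 * (\<tau> i)\<^sup>2\<close> is at most
  \<open>s i * \<kappa> i - (s i)\<^sup>2\<close>, and these sum to Tr \<open>r x * L\<close> - Tr
  \<open>r x * r x\<close>: the overlaps with the other elements of \<open>J\<close>.\<close>

lemma square_root_measurement:
  assumes J: "finite J" and r: "\<And>x. x \<in> J \<Longrightarrow> psd n (r x)"
  shows "\<exists>M. (\<forall>x\<in>J. psd n (M x)) \<and> psd n (1\<^sub>m n - msum n M J) \<and>
    (\<forall>x\<in>J. Re (mtrace (r x * r x)) - Re (mtrace (r x * r x * M x))
       \<le> (\<Sum>y\<in>J - {x}. Re (mtrace (r x * r y))))"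
proof -
  note ac = assoc_mult_mat[of _ n n _ n _ n] mult_carrier_mat[of _ n n _ n]
  have rc: "r x \<in> carrier_mat n n" if "x \<in> J" for x using psd_carrier[OF r[OF that]] .
  define L where "L = msum n r J"
  have Lc: "L \<in> carrier_mat n n" by (simp add: L_def)
  have "psd n L" using r by (auto simp: L_def intro: psd_msum)
  then obtain U l where U: "unitary n U" and l: "\<forall>i<n. 0 \<le> l i" and L: "L = spec n U l"
    by (rule psd_spectral)
  note u = unitaryD[OF U]
  define T where "T = spec n U (\<lambda>i. 1 / sqrt (l i))"
  have T: "psd n T" unfolding T_def using l by (intro psd_spec[OF U]) simp
  note Tc = psd_carrier[OF T] and Th = psd_hermitian[OF T]
  define M where "M x = T * r x * T" for x
  have Mpsd: "psd n (M x)" if "x \<in> J" for x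
    using psd_conj[OF r[OF that] Tc] by (simp add: Th M_def)
  have "msum n M J = T * L * T"
    unfolding M_def L_def using Tc rc
    by (simp add: mult_msum msum_mult mult_carrier_mat[of _ n n _ n])
  also have "\<dots> = spec n U (\<lambda>i. 1 / sqrt (l i) * l i * (1 / sqrt (l i)))"
    by (simp add: T_def L spec_mult[OF U])
  finally have "1\<^sub>m n - msum n M J = spec n U (\<lambda>i. 1 - 1 / sqrt (l i) * l i * (1 / sqrt (l i)))"
    by (simp add: spec_one[OF U, symmetric] spec_diff[OF U])
  \<comment> \<open>The value is 1 on the support of \<open>L\<close> and 0 on its kernel, where
    \<open>1 / sqrt 0\<close> is 0. The operators \<open>M x\<close> thus sum to the support
    projection, possibly less than the identity.\<close>
  moreover have "1 / sqrt (l i) * l i * (1 / sqrt (l i)) \<le> 1" if "i < n" for i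
    using l that by (cases "l i = 0") (auto simp: field_simps)
  ultimately have compl: "psd n (1\<^sub>m n - msum n M J)"
    using psd_spec[OF U] by simp
  have "Re (mtrace (r x * r x)) - Re (mtrace (r x * r x * M x)) \<le> (\<Sum>y\<in>J - {x}. Re (mtrace (r x * r y)))"
    if x: "x \<in> J" for x
  proof -
    obtain W s where W: "unitary n W" and s: "\<forall>i<n. 0 \<le> s i" and rx: "r x = spec n W s"
      by (rule psd_spectral[OF r[OF x]])
    note w = unitaryD[OF W]
    \<comment> \<open>The transition matrix between the eigenbases of \<open>r x\<close> and
      \<open>L\<close>. Its squared moduli \<open>p\<close> are the common weights of \<tau> and
      \<kappa>, and unitarity makes every row a probability vector.\<close>
    define Q where "Q = adj W * U"
    have Q: "unitary n Q" unfolding Q_def by (rule unitary_mult[OF unitary_adj[OF W] U])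
    note q = unitaryD[OF Q]
    have aQ: "adj Q = adj U * W" by (simp add: Q_def adj_mult[OF w(2) u(1)])
    define p where "p i j = (cmod (Q $$ (i, j)))\<^sup>2" for i j
    have p1: "(\<Sum>j<n. p i j) = 1" if "i < n" for i
      using spec_diag_entry[OF q(1) that, of "\<lambda>_. 1"] that by (simp add: spec_one[OF Q] p_def flip: of_real_sum)
    define \<tau> where "\<tau> i = (\<Sum>j<n. 1 / sqrt (l j) * p i j)" for i
    define \<kappa> where "\<kappa> i = (\<Sum>j<n. l j * p i j)" for i
    have \<tau>: "(adj W * T * W) $$ (i, i) = complex_of_real (\<tau> i)" if "i < n" for i
      using spec_diag_entry[OF q(1) that]
      by (simp add: T_def spec_conj[OF U w(1)] \<tau>_def p_def Q_def)
    have \<kappa>: "(adj W * L * W) $$ (i, i) = complex_of_real (\<kappa> i)" if "i < n" for i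
      using spec_diag_entry[OF q(1) that]
      by (simp add: L spec_conj[OF U w(1)] \<kappa>_def p_def Q_def)
    \<comment> \<open>\<open>L\<close> dominates \<open>r x\<close>, hence its diagonal in the
      eigenbasis of \<open>L\<close> dominates that of \<open>r x\<close>. Where \<open>l j\<close>
      is 0 and \<open>s i\<close> is not, the weight \<open>p i j\<close> must vanish: the support
      hypothesis of the scalar bound.\<close>
    have dom: "s i * p i j \<le> l j" if ij: "i < n" "j < n" for i j
    proof -
      have entry: "(adj U * r x * U) $$ (j, j) = complex_of_real (\<Sum>i<n. s i * p i j)"
        using spec_diag_entry[OF q(2) ij(2), of s] ij q(1)
        by (simp add: rx spec_conj[OF W u(1)] p_def flip: aQ)
      have "adj U * L * U = msum n (\<lambda>y. adj U * r y * U) J"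
        unfolding L_def using u rc by (simp add: mult_msum msum_mult mult_carrier_mat[of _ n n _ n])
      then have "(adj U * L * U) $$ (j, j) = (\<Sum>y\<in>J. (adj U * r y * U) $$ (j, j))"
        using ij by (simp add: msum_def)
      then have "complex_of_real (l j) = (\<Sum>y\<in>J. (adj U * r y * U) $$ (j, j))"
        using ij by (simp add: L spec_conj_self[OF U] diagm_def)
      then have lj: "l j = (\<Sum>y\<in>J. Re ((adj U * r y * U) $$ (j, j)))"
        by (metis Re_complex_of_real Re_sum)
      have "s i * p i j \<le> (\<Sum>i<n. s i * p i j)"
        using ij s by (intro member_le_sum) (auto simp: p_def)
      also have "\<dots> = Re ((adj U * r x * U) $$ (j, j))" by (simp add: entry)
      also have "\<dots> \<le> l j"
        unfolding lj
      proof (rule member_le_sum[OF x _ J])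
        fix y assume "y \<in> J - {x}"
        then show "0 \<le> Re ((adj U * r y * U) $$ (j, j))"
          using psd_diag_nonneg[OF psd_conj[OF r u(1)] ij(2)] by (simp add: less_eq_complex_def)
      qed
      finally show ?thesis .
    qed
    have key: "(s i)\<^sup>2 - (s i)^3 * (\<tau> i)\<^sup>2 \<le> s i * \<kappa> i - (s i)\<^sup>2" if i: "i < n" for i
    proof (cases "s i = 0")
      case False
      then have si: "0 < s i" using s i by (simp add: less_le)
      have "2 * s i - \<kappa> i \<le> (s i)\<^sup>2 * (\<tau> i)\<^sup>2"
        unfolding \<kappa>_def \<tau>_def
      proof (rule inverse_sqrt_mean_bound[OF _ p1[OF i] _ _ si])
        fix j assume j: "j < n" and "l j = 0"
        then show "p i j = 0" using dom[OF i j] si by (auto simp: p_def mult_le_0_iff)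
      qed (use l in \<open>auto simp: p_def\<close>)
      then have "s i * (2 * s i - \<kappa> i) \<le> s i * ((s i)\<^sup>2 * (\<tau> i)\<^sup>2)"
        using si by (intro mult_left_mono) auto
      then show ?thesis by (simp add: algebra_simps power2_eq_square power3_eq_cube)
    qed simp
    have tr_rr: "Re (mtrace (r x * r x)) = (\<Sum>i<n. (s i)\<^sup>2)"
    proof -
      have "mtrace (r x * r x) = (\<Sum>i<n. complex_of_real (s i) * complex_of_real (s i))"
        using mtrace_spec_mult[OF W rc[OF x], of s] spec_conj_self[OF W, of s]
        by (simp add: rx diagm_def)
      then show ?thesis by (simp add: power2_eq_square flip: of_real_mult of_real_sum)
    qed
    have tr_rL: "(\<Sum>i<n. s i * \<kappa> i) = Re (mtrace (r x * r x)) + (\<Sum>y\<in>J - {x}. Re (mtrace (r x * r y)))"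
    proof -
      have "complex_of_real (\<Sum>i<n. s i * \<kappa> i) = mtrace (r x * L)"
        using mtrace_spec_mult[OF W Lc, of s] by (simp add: rx \<kappa>)
      also have "\<dots> = (\<Sum>y\<in>J. mtrace (r x * r y))"
        unfolding L_def using rc x by (simp add: mult_msum mtrace_msum mult_carrier_mat[of _ n n _ n])
      finally have "(\<Sum>i<n. s i * \<kappa> i) = (\<Sum>y\<in>J. Re (mtrace (r x * r y)))"
        by (metis Re_complex_of_real Re_sum)
      then show ?thesis using sum.remove[OF J x] by simp
    qed
    have "(\<Sum>i<n. (s i)^3 * (\<tau> i)\<^sup>2)
        \<le> (\<Sum>i<n. \<Sum>j<n. (s i)\<^sup>2 * s j * (cmod ((adj W * T * W) $$ (i, j)))\<^sup>2)"
    proof (rule sum_mono)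
      fix i assume "i \<in> {..<n}"
      then have i: "i < n" by simp
      have "(s i)^3 * (\<tau> i)\<^sup>2 = (s i)\<^sup>2 * s i * (cmod ((adj W * T * W) $$ (i, i)))\<^sup>2"
        by (simp add: \<tau>[OF i] power2_eq_square power3_eq_cube)
      also have "\<dots> \<le> (\<Sum>j<n. (s i)\<^sup>2 * s j * (cmod ((adj W * T * W) $$ (i, j)))\<^sup>2)"
        using i s by (intro member_le_sum[of i "{..<n}" "\<lambda>j. (s i)\<^sup>2 * s j * (cmod ((adj W * T * W) $$ (i, j)))\<^sup>2"]) auto
      finally show "(s i)^3 * (\<tau> i)\<^sup>2 \<le> (\<Sum>j<n. (s i)\<^sup>2 * s j * (cmod ((adj W * T * W) $$ (i, j)))\<^sup>2)" .
    qed
    also have "\<dots> = Re (mtrace (r x * r x * M x))"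
    proof -
      have "r x * r x * M x = spec n W (\<lambda>i. (s i)\<^sup>2) * T * spec n W s * T"
        using W Tc by (simp add: rx M_def spec_mult[OF W] power2_eq_square ac)
      then show ?thesis by (simp add: mtrace_spec_mult_spec[OF W Tc Th])
    qed
    finally have "Re (mtrace (r x * r x)) - Re (mtrace (r x * r x * M x))
        \<le> (\<Sum>i<n. (s i)\<^sup>2 - (s i)^3 * (\<tau> i)\<^sup>2)"
      by (simp add: tr_rr sum_subtractf)
    also have "\<dots> \<le> (\<Sum>i<n. s i * \<kappa> i - (s i)\<^sup>2)" using key by (intro sum_mono) auto
    also have "\<dots> = (\<Sum>y\<in>J - {x}. Re (mtrace (r x * r y)))"
      by (simp add: sum_subtractf tr_rL tr_rr)
    finally show ?thesis .
  qed
  with Mpsd compl show ?thesis by blast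
qed

subsection \<open>Kronecker products and classical-quantum operators\<close>

lemma kron_carrier [simp]:
  "A \<in> carrier_mat n m \<Longrightarrow> B \<in> carrier_mat k l \<Longrightarrow> kron A B \<in> carrier_mat (n * k) (m * l)"
  by (auto simp: kron_def)

lemma dim_kron [simp]:
  "dim_row (kron A B) = dim_row A * dim_row B" "dim_col (kron A B) = dim_col A * dim_col B"
  by (simp_all add: kron_def)

lemma div_mod_bounds:
  assumes "i < n * (k :: nat)"
  shows "i div k < n" "i mod k < k"
  using assms by (cases "k = 0"; simp add: less_mult_imp_div_less)+

lemma index_kron:
  assumes "A \<in> carrier_mat n m" "B \<in> carrier_mat k l" "i < n * k" "j < m * l"
  shows "kron A B $$ (i, j) = A $$ (i div k, j div l) * B $$ (i mod k, j mod l)"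
  using assms by (simp add: kron_def)

lemma sum_div_mod:
  fixes f :: "nat \<Rightarrow> nat \<Rightarrow> 'a :: comm_monoid_add"
  shows "(\<Sum>k<m * l. f (k div l) (k mod l)) = (\<Sum>a<m. \<Sum>b<l. f a b)"
proof -
  have "(\<Sum>k<m * l. f (k div l) (k mod l)) = (\<Sum>(a, b)\<in>{..<m} \<times> {..<l}. f a b)"
  proof (rule sum.reindex_bij_witness[of _ "\<lambda>(a, b). a * l + b" "\<lambda>k. (k div l, k mod l)"])
    fix k assume "k \<in> {..<m * l}"
    then show "(k div l, k mod l) \<in> {..<m} \<times> {..<l}" using div_mod_bounds[of k m l] by auto
  next
    fix p assume "p \<in> {..<m} \<times> {..<l}"
    then obtain a b where p: "p = (a, b)" "a < m" "b < l" by auto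
    have "a * l + b < Suc a * l" using p by simp
    also have "\<dots> \<le> m * l" using p by (intro mult_right_mono) auto
    finally show "(case p of (a, b) \<Rightarrow> a * l + b) \<in> {..<m * l}" using p by simp
  qed auto
  then show ?thesis by (simp add: sum.cartesian_product)
qed

lemma kron_mult:
  assumes A: "A \<in> carrier_mat n m" and C: "C \<in> carrier_mat m p"
    and B: "B \<in> carrier_mat k l" and D: "D \<in> carrier_mat l q"
  shows "kron A B * kron C D = kron (A * C) (B * D)"
proof (rule eq_matI)
  fix i j assume "i < dim_row (kron (A * C) (B * D))" "j < dim_col (kron (A * C) (B * D))"
  then have ij: "i < n * k" "j < p * q" using A B C D by auto
  note b = div_mod_bounds[OF ij(1)] div_mod_bounds[OF ij(2)]
  have "(kron A B * kron C D) $$ (i, j) = (\<Sum>s<m * l. kron A B $$ (i, s) * kron C D $$ (s, j))"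
    by (rule index_mult[OF kron_carrier[OF A B] kron_carrier[OF C D] ij])
  also have "\<dots> = (\<Sum>s<m * l. (A $$ (i div k, s div l) * C $$ (s div l, j div q))
      * (B $$ (i mod k, s mod l) * D $$ (s mod l, j mod q)))"
    using ij by (intro sum.cong refl) (simp add: index_kron[OF A B] index_kron[OF C D])
  also have "\<dots> = (\<Sum>a<m. \<Sum>b<l. (A $$ (i div k, a) * C $$ (a, j div q)) * (B $$ (i mod k, b) * D $$ (b, j mod q)))"
    by (rule sum_div_mod)
  also have "\<dots> = (A * C) $$ (i div k, j div q) * (B * D) $$ (i mod k, j mod q)"
    unfolding index_mult[OF A C b(1,3)] index_mult[OF B D b(2,4)] sum_product ..
  also have "\<dots> = kron (A * C) (B * D) $$ (i, j)"
    by (rule index_kron[OF mult_carrier_mat[OF A C] mult_carrier_mat[OF B D] ij, symmetric])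
  finally show "(kron A B * kron C D) $$ (i, j) = kron (A * C) (B * D) $$ (i, j)" .
qed (use assms in auto)

lemma adj_kron: "adj (kron A B) = kron (adj A) (adj B)"
proof (rule eq_matI)
  fix i j assume "i < dim_row (kron (adj A) (adj B))" "j < dim_col (kron (adj A) (adj B))"
  then have ij: "i < dim_col A * dim_col B" "j < dim_row A * dim_row B" by auto
  then show "adj (kron A B) $$ (i, j) = kron (adj A) (adj B) $$ (i, j)"
    using div_mod_bounds[OF ij(1)] div_mod_bounds[OF ij(2)] by (simp add: kron_def)
qed auto

lemma kron_one_left [simp]: "kron (1\<^sub>m (Suc 0)) A = A"
  by (rule eq_matI) (auto simp: kron_def)

lemma kron_zero [simp]:
  "kron (0\<^sub>m n m) A = 0\<^sub>m (n * dim_row A) (m * dim_col A)"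
  "kron A (0\<^sub>m n m) = 0\<^sub>m (dim_row A * n) (dim_col A * m)"
  using div_mod_bounds by (auto intro!: eq_matI simp: kron_def)

lemma kron_smult_left: "kron (c \<cdot>\<^sub>m A) B = kron A (c \<cdot>\<^sub>m B)"
  using div_mod_bounds by (auto intro!: eq_matI simp: kron_def)

text \<open>It is the Gram matrix of \<open>kron (1\<^sub>m n) S\<close>, where \<open>S\<close> is
  the root of \<open>A\<close>.\<close>

lemma psd_kron_one:
  assumes "psd d A"
  shows "psd (n * d) (kron (1\<^sub>m n) A)"
proof -
  define S where "S = msqrt A"
  have S: "psd d S" "S * S = A" using psd_msqrt[OF assms] by (auto simp: S_def)
  note c = psd_carrier[OF S(1)]
  have "adj (kron (1\<^sub>m n) S) * kron (1\<^sub>m n) S = kron (1\<^sub>m n) A"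
    using c by (simp add: adj_kron psd_hermitian[OF S(1)] kron_mult[of _ n n _ n _ d d _ d] S(2))
  moreover have "psd (n * d) (adj (kron (1\<^sub>m n) S) * kron (1\<^sub>m n) S)"
    using c by (intro psd_gram[of _ "n * d"]) auto
  ultimately show ?thesis by simp
qed

lemma psd_smult:
  assumes "psd n A" "0 \<le> c"
  shows "psd n (complex_of_real c \<cdot>\<^sub>m A)"
  unfolding psd_alt
proof (intro conjI allI)
  have A: "A \<in> carrier_mat n n" using assms(1) by (rule psd_carrier)
  then show "complex_of_real c \<cdot>\<^sub>m A \<in> carrier_mat n n" by simp
  fix v
  have "(\<Sum>i<n. \<Sum>j<n. cnj (v i) * (complex_of_real c \<cdot>\<^sub>m A) $$ (i, j) * v j)
      = complex_of_real c * (\<Sum>i<n. \<Sum>j<n. cnj (v i) * A $$ (i, j) * v j)"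
    using A by (simp add: sum_distrib_left mult_ac)
  moreover have "0 \<le> (\<Sum>i<n. \<Sum>j<n. cnj (v i) * A $$ (i, j) * v j)"
    using assms(1) by (simp add: psd_alt)
  ultimately show "0 \<le> (\<Sum>i<n. \<Sum>j<n. cnj (v i) * (complex_of_real c \<cdot>\<^sub>m A) $$ (i, j) * v j)"
    using assms(2) by (simp add: less_eq_complex_def)
qed

lemma mtrace_smult: "mtrace (c \<cdot>\<^sub>m A) = c * mtrace A" if "A \<in> carrier_mat n n"
  using that by (simp add: mtrace_def sum_distrib_left)

lemma mtrace_psd: "psd n A \<Longrightarrow> mtrace A = complex_of_real (Re (mtrace A))"
  using psd_diag_nonneg[of n A] psd_carrier[of n A]
  by (simp add: complex_eq_iff mtrace_def less_eq_complex_def)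

lemma conj_msum:
  assumes C: "C \<in> carrier_mat n m" and f: "\<And>k. k \<in> I \<Longrightarrow> f k \<in> carrier_mat n n"
  shows "adj C * msum n f I * C = msum m (\<lambda>k. adj C * f k * C) I"
proof (rule eq_matI)
  fix i j assume "i < dim_row (msum m (\<lambda>k. adj C * f k * C) I)" "j < dim_col (msum m (\<lambda>k. adj C * f k * C) I)"
  then have ij: "i < m" "j < m" by (auto simp: msum_def)
  have "(adj C * msum n f I * C) $$ (i, j)
      = (\<Sum>b<n. \<Sum>a<n. cnj (C $$ (a, i)) * msum n f I $$ (a, b) * C $$ (b, j))"
    by (rule index_conj[OF msum_carrier C ij])
  also have "\<dots> = (\<Sum>b<n. \<Sum>a<n. \<Sum>k\<in>I. cnj (C $$ (a, i)) * f k $$ (a, b) * C $$ (b, j))"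
    by (simp add: msum_def sum_distrib_left sum_distrib_right)
  also have "\<dots> = (\<Sum>k\<in>I. \<Sum>b<n. \<Sum>a<n. cnj (C $$ (a, i)) * f k $$ (a, b) * C $$ (b, j))"
    by (subst (2) sum.swap, subst sum.swap, rule refl)
  also have "\<dots> = (\<Sum>k\<in>I. (adj C * f k * C) $$ (i, j))"
    by (intro sum.cong refl, rule index_conj[OF f C ij, symmetric])
  finally show "(adj C * msum n f I * C) $$ (i, j) = msum m (\<lambda>k. adj C * f k * C) I $$ (i, j)"
    using ij by (simp add: msum_def)
qed (use C in \<open>auto simp: msum_def\<close>)

lemma mult_assoc_outer:
  fixes A :: "'a :: semiring_0 mat"
  assumes A: "A \<in> carrier_mat n1 n2" and B: "B \<in> carrier_mat n2 n3" and R: "R \<in> carrier_mat n3 n4"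
    and D: "D \<in> carrier_mat n4 n5" and E: "E \<in> carrier_mat n5 n6"
  shows "A * (B * R * D) * E = (A * B) * R * (D * E)"
  unfolding assoc_mult_mat[OF A mult_carrier_mat[OF B R] D, symmetric] assoc_mult_mat[OF A B R, symmetric]
  by (rule assoc_mult_mat[OF mult_carrier_mat[OF mult_carrier_mat[OF A B] R] D E])

lemma mult_assoc_inner:
  fixes P :: "'a :: semiring_0 mat"
  assumes P: "P \<in> carrier_mat n1 n2" and R: "R \<in> carrier_mat n2 n3" and Q: "Q \<in> carrier_mat n3 n4"
    and S: "S \<in> carrier_mat n4 n5" and T: "T \<in> carrier_mat n5 n6" and V: "V \<in> carrier_mat n6 n7"
  shows "(P * R * Q) * (S * T * V) = P * (R * (Q * S) * T) * V"
proof -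
  note QS = mult_carrier_mat[OF Q S] and ST = mult_carrier_mat[OF S T] and PR = mult_carrier_mat[OF P R]
  have "(P * R * Q) * (S * T * V) = P * R * (Q * (S * T) * V)"
    unfolding assoc_mult_mat[OF PR Q mult_carrier_mat[OF ST V]] assoc_mult_mat[OF Q ST V] ..
  also have "\<dots> = P * R * (Q * S * T) * V"
    unfolding assoc_mult_mat[OF Q S T]
    by (rule assoc_mult_mat[OF PR mult_carrier_mat[OF Q ST] V, symmetric])
  also have "P * R * (Q * S * T) = P * (R * (Q * S) * T)"
    unfolding assoc_mult_mat[OF R QS T] by (rule assoc_mult_mat[OF P R mult_carrier_mat[OF QS T]])
  finally show ?thesis .
qed

section \<open>Block-diagonal operators along isometries with orthogonal ranges\<close>

locale orthogonal_embeddings =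
  fixes N d :: nat and C :: "'x \<Rightarrow> complex mat" and I :: "'x set"
  assumes finite_I: "finite I"
    and C_carrier: "x \<in> I \<Longrightarrow> C x \<in> carrier_mat N d"
    and C_ortho: "x \<in> I \<Longrightarrow> y \<in> I \<Longrightarrow> adj (C x) * C y = (if x = y then 1\<^sub>m d else 0\<^sub>m d d)"
begin

text \<open>With \<open>C x\<close> the ket of \<open>x\<close> tensored with the identity on
  \<open>B\<close>, this is the classical-quantum operator. Products, roots and traces can then be
  taken block by block, away from the index arithmetic of \<open>kron\<close>.\<close>

definition blocks :: "('x \<Rightarrow> complex mat) \<Rightarrow> complex mat" where
  "blocks r = msum N (\<lambda>x. C x * r x * adj (C x)) I"

lemma block_carrier: "x \<in> I \<Longrightarrow> A \<in> carrier_mat d d \<Longrightarrow> C x * A * adj (C x) \<in> carrier_mat N N"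
  using C_carrier[of x] by auto

lemma blocks_carrier [simp]: "blocks r \<in> carrier_mat N N"
  by (simp add: blocks_def)

text \<open>Together with \<open>psd_conj\<close> this passes positivity from the whole operator to
  each block.\<close>

lemma conj_blocks:
  assumes r: "\<And>y. y \<in> I \<Longrightarrow> r y \<in> carrier_mat d d" and x: "x \<in> I"
  shows "adj (C x) * blocks r * C x = r x"
proof -
  have "adj (C x) * (C y * r y * adj (C y)) * C x = (if y = x then r y else 0\<^sub>m d d)" if y: "y \<in> I" for y
  proof -
    note c = C_carrier[OF x] C_carrier[OF y] adj_carrier[OF C_carrier[OF x]] adj_carrier[OF C_carrier[OF y]] r[OF y]
    have "adj (C x) * (C y * r y * adj (C y)) * C x = (adj (C x) * C y) * r y * (adj (C y) * C x)"
      by (rule mult_assoc_outer[OF c(3,2) c(5,4) c(1)])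
    then show ?thesis
      using left_mult_one_mat[OF c(5)] right_mult_one_mat[OF c(5)] c(5) by (auto simp: C_ortho x y)
  qed
  note eq = this
  have "adj (C x) * blocks r * C x = msum d (\<lambda>y. adj (C x) * (C y * r y * adj (C y)) * C x) I"
    unfolding blocks_def by (rule conj_msum[OF C_carrier[OF x] block_carrier[OF _ r]])
  also have "\<dots> = msum d (\<lambda>y. if y = x then r y else 0\<^sub>m d d) I"
    by (rule msum_cong) (rule eq)
  also have "\<dots> = r x"
    using msum_delta[where f = r and a = x, OF finite_I x r[OF x]] .
  finally show ?thesis .
qed

lemma psd_blocks:
  assumes "\<And>x. x \<in> I \<Longrightarrow> psd d (r x)"
  shows "psd N (blocks r)"
  unfolding blocks_def
proof (rule psd_msum)
  fix x assume x: "x \<in> I"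
  show "psd N (C x * r x * adj (C x))"
    using psd_conj[OF assms[OF x] adj_carrier[OF C_carrier[OF x]]] by simp
qed

lemma blocks_mult:
  assumes r: "\<And>x. x \<in> I \<Longrightarrow> r x \<in> carrier_mat d d" and q: "\<And>x. x \<in> I \<Longrightarrow> q x \<in> carrier_mat d d"
  shows "blocks r * blocks q = blocks (\<lambda>x. r x * q x)"
proof -
  have "(C x * r x * adj (C x)) * (C y * q y * adj (C y))
      = (if x = y then C x * (r x * q x) * adj (C x) else 0\<^sub>m N N)" if x: "x \<in> I" and y: "y \<in> I" for x y
  proof -
    note c = C_carrier[OF x] C_carrier[OF y] adj_carrier[OF C_carrier[OF x]] adj_carrier[OF C_carrier[OF y]]
      r[OF x] q[OF y]
    have "(C x * r x * adj (C x)) * (C y * q y * adj (C y))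
        = C x * (r x * (adj (C x) * C y) * q y) * adj (C y)"
      by (rule mult_assoc_inner[OF c(1,5,3,2,6,4)])
    then show ?thesis
      by (simp only: C_ortho[OF x y] right_mult_one_mat[OF c(5)] right_mult_zero_mat[OF c(5)]
          left_mult_zero_mat[OF c(6)] right_mult_zero_mat[OF c(1)] left_mult_zero_mat[OF c(4)] split: if_split)
        simp
  qed
  note eq = this
  have "blocks r * blocks q = msum N (\<lambda>y. msum N (\<lambda>x. (C x * r x * adj (C x)) * (C y * q y * adj (C y))) I) I"
    unfolding blocks_def
    by (subst mult_msum; (intro block_carrier q msum_carrier; assumption)?)
      (intro msum_cong msum_mult block_carrier q r)
  also have "\<dots> = msum N (\<lambda>y. C y * (r y * q y) * adj (C y)) I"
  proof (rule msum_cong)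
    fix y assume y: "y \<in> I"
    have "msum N (\<lambda>x. (C x * r x * adj (C x)) * (C y * q y * adj (C y))) I
        = msum N (\<lambda>x. if x = y then C x * (r x * q x) * adj (C x) else 0\<^sub>m N N) I"
      by (rule msum_cong) (simp add: eq y)
    also have "\<dots> = C y * (r y * q y) * adj (C y)"
      using msum_delta[where f = "\<lambda>x. C x * (r x * q x) * adj (C x)" and a = y, OF finite_I y
          block_carrier[OF y mult_carrier_mat[OF r[OF y] q[OF y]]]] .
    finally show "msum N (\<lambda>x. (C x * r x * adj (C x)) * (C y * q y * adj (C y))) I = C y * (r y * q y) * adj (C y)" .
  qed
  finally show ?thesis by (simp add: blocks_def)
qed

text \<open>By uniqueness of the root: the blockwise roots form a positive semidefinite operator,
  and orthogonality of the ranges lets it square to \<open>blocks r\<close>.\<close>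

lemma msqrt_blocks:
  assumes r: "\<And>x. x \<in> I \<Longrightarrow> psd d (r x)"
  shows "msqrt (blocks r) = blocks (\<lambda>x. msqrt (r x))"
proof (rule msqrt_eq[OF psd_blocks])
  show "psd d (msqrt (r x))" if "x \<in> I" for x using psd_msqrt[OF r[OF that]] by blast
  then have "blocks (\<lambda>x. msqrt (r x)) * blocks (\<lambda>x. msqrt (r x)) = blocks (\<lambda>x. msqrt (r x) * msqrt (r x))"
    by (intro blocks_mult psd_carrier)
  also have "\<dots> = blocks r"
    unfolding blocks_def using psd_msqrt(2)[OF r] by (intro msum_cong) simp
  finally show "blocks (\<lambda>x. msqrt (r x)) * blocks (\<lambda>x. msqrt (r x)) = blocks r" .
qed

text \<open>Only the compressions of \<open>K\<close> enter. For \<open>K\<close> of the form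
  identity tensor \<tau> each of them is \<tau>, and the trace collapses to one over
  \<open>B\<close> alone.\<close>

lemma mtrace_blocks_mult:
  assumes r: "\<And>x. x \<in> I \<Longrightarrow> r x \<in> carrier_mat d d" and K: "K \<in> carrier_mat N N"
  shows "mtrace (blocks r * K) = (\<Sum>x\<in>I. mtrace (r x * (adj (C x) * K * C x)))"
proof -
  have "blocks r * K = msum N (\<lambda>x. C x * r x * adj (C x) * K) I"
    unfolding blocks_def using K r by (intro msum_mult block_carrier)
  then have "mtrace (blocks r * K) = (\<Sum>x\<in>I. mtrace (C x * r x * adj (C x) * K))"
    using K r by (simp add: mtrace_msum mult_carrier_mat[OF block_carrier])
  also have "\<dots> = (\<Sum>x\<in>I. mtrace (r x * (adj (C x) * K * C x)))"
  proof (rule sum.cong[OF refl])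
    fix x assume x: "x \<in> I"
    note c = C_carrier[OF x] adj_carrier[OF C_carrier[OF x]] r[OF x] K
    have "C x * r x * adj (C x) * K = C x * (r x * (adj (C x) * K))"
      unfolding assoc_mult_mat[OF mult_carrier_mat[OF c(1,3)] c(2,4)]
      by (rule assoc_mult_mat[OF c(1,3) mult_carrier_mat[OF c(2,4)]])
    also have "mtrace \<dots> = mtrace (r x * (adj (C x) * K) * C x)"
      using c by (intro mtrace_comm[of _ N d]) auto
    also have "r x * (adj (C x) * K) * C x = r x * (adj (C x) * K * C x)"
      using c by (intro assoc_mult_mat[of _ d d _ N _ d]) auto
    finally show "mtrace (C x * r x * adj (C x) * K) = mtrace (r x * (adj (C x) * K * C x))" .
  qed
  finally show ?thesis .
qed

end

section \<open>Orthonormality of the \<open>x\<close> basis, and bit strings\<close>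

lemma qubit_xket_ortho:
  "adj (qubit_xket a) * qubit_xket b = (if a = b then 1\<^sub>m 1 else 0\<^sub>m 1 1)"
proof (rule eq_matI)
  have q: "qubit_xket c \<in> carrier_mat 2 1" for c by (simp add: qubit_xket_def)
  fix i j assume "i < dim_row (if a = b then 1\<^sub>m 1 else 0\<^sub>m 1 1 :: complex mat)"
    "j < dim_col (if a = b then 1\<^sub>m 1 else 0\<^sub>m 1 1 :: complex mat)"
  then have ij: "i = 0" "j = 0" by (auto split: if_splits)
  have "complex_of_real (sqrt 2) * complex_of_real (sqrt 2) = 2"
    by (simp flip: of_real_mult)
  then show "(adj (qubit_xket a) * qubit_xket b) $$ (i, j) = (if a = b then 1\<^sub>m 1 else 0\<^sub>m 1 1) $$ (i, j)"
    unfolding ij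
    by (subst index_mult[OF adj_carrier[OF q] q]; cases a; cases b)
      (simp_all add: qubit_xket_def numeral_2_eq_2 lessThan_Suc field_simps)
qed (auto simp: qubit_xket_def)

lemma xket_list_carrier:
  "foldr (\<lambda>b. kron (qubit_xket b)) bs (1\<^sub>m 1) \<in> carrier_mat (2 ^ length bs) 1"
proof (induction bs)
  case (Cons b bs)
  have "qubit_xket b \<in> carrier_mat 2 1" by (simp add: qubit_xket_def)
  from kron_carrier[OF this Cons.IH] show ?case by simp
qed simp

lemma xket_list_ortho:
  assumes "length as = length bs"
  shows "adj (foldr (\<lambda>b. kron (qubit_xket b)) as (1\<^sub>m 1)) * foldr (\<lambda>b. kron (qubit_xket b)) bs (1\<^sub>m 1)
    = (if as = bs then 1\<^sub>m 1 else 0\<^sub>m 1 1)"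
  using assms
proof (induction as bs rule: list_induct2)
  case (Cons a as b bs)
  have q: "qubit_xket c \<in> carrier_mat 2 1" for c by (simp add: qubit_xket_def)
  note as = xket_list_carrier[of as] and bs = xket_list_carrier[of bs, folded Cons.hyps]
  have "kron (adj (qubit_xket a)) (adj (foldr (\<lambda>b. kron (qubit_xket b)) as (1\<^sub>m 1)))
      * kron (qubit_xket b) (foldr (\<lambda>b. kron (qubit_xket b)) bs (1\<^sub>m 1))
      = kron (if a = b then 1\<^sub>m 1 else 0\<^sub>m 1 1) (if as = bs then 1\<^sub>m 1 else 0\<^sub>m 1 1)"
    unfolding kron_mult[OF adj_carrier[OF q] q adj_carrier[OF as] bs] qubit_xket_ortho Cons.IH ..
  then show ?case by (auto simp: adj_kron)
qed simp

lemma xket_carrier: "x \<in> carrier_vec n \<Longrightarrow> xket x \<in> carrier_mat (2 ^ n) 1"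
  using xket_list_carrier[of "list_of_vec x"] by (simp add: xket_def)

lemma xket_ortho:
  assumes "x \<in> carrier_vec n" "y \<in> carrier_vec n"
  shows "adj (xket x) * xket y = (if x = y then 1\<^sub>m 1 else 0\<^sub>m 1 1)"
proof -
  have "list_of_vec x = list_of_vec y \<longleftrightarrow> x = y" by (metis vec_list)
  then show ?thesis
    using xket_list_ortho[of "list_of_vec x" "list_of_vec y"] assms by (simp add: xket_def)
qed

lemma finite_bit_vecs: "finite (carrier_vec n :: bit vec set)"
proof -
  have UNIV: "(UNIV :: bit set) = {0, 1}" using bit_not_one_iff by auto
  have "(carrier_vec n :: bit vec set) \<subseteq> vec_of_list ` {bs. set bs \<subseteq> UNIV \<and> length bs = n}"
    by (auto intro!: image_eqI[of _ _ "list_of_vec _"] simp: vec_list)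
  then show ?thesis
    by (rule finite_subset) (intro finite_imageI finite_lists_length_eq, simp add: UNIV)
qed

lemma bit_vec_add_eq_zero_iff:
  fixes x y :: "bit vec"
  assumes "x \<in> carrier_vec n" "y \<in> carrier_vec n"
  shows "x + y = 0\<^sub>v n \<longleftrightarrow> x = y"
proof -
  have "a + b = 0 \<longleftrightarrow> a = b" for a b :: bit by (cases a; cases b) auto
  then show ?thesis using assms by (auto simp: vec_eq_iff)
qed

lemma linear_fun_add:
  assumes "linear_fun n k g" "x \<in> carrier_vec n" "y \<in> carrier_vec n"
  shows "g x \<in> carrier_vec k" "g (x + y) = g x + g y"
  using assms by (auto simp: linear_fun_def module_hom_def module_vec_def)

interpretation x_basis: orthogonal_embeddings "2 ^ n * d" d "\<lambda>x. kron (xket x) (1\<^sub>m d)" "carrier_vec n" for n d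
proof
  fix x y :: "bit vec" assume x: "x \<in> carrier_vec n" and y: "y \<in> carrier_vec n"
  show "kron (xket x) (1\<^sub>m d) \<in> carrier_mat (2 ^ n * d) d"
    using kron_carrier[OF xket_carrier[OF x] one_carrier_mat[of d]] by simp
  show "adj (kron (xket x) (1\<^sub>m d)) * kron (xket y) (1\<^sub>m d) = (if x = y then 1\<^sub>m d else 0\<^sub>m d d)"
    unfolding adj_kron adj_one
      kron_mult[OF adj_carrier[OF xket_carrier[OF x]] xket_carrier[OF y] one_carrier_mat one_carrier_mat]
      xket_ortho[OF x y] by simp
qed (rule finite_bit_vecs)

lemma cq_operator_blocks:
  assumes "\<And>x. x \<in> carrier_vec n \<Longrightarrow> \<rho> x \<in> carrier_mat d d"
  shows "cq_operator n d \<rho> = x_basis.blocks n d \<rho>"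
  unfolding cq_operator_def x_basis.blocks_def
proof (rule msum_cong)
  fix x :: "bit vec" assume x: "x \<in> carrier_vec n"
  note k = xket_carrier[OF x] and r = assms[OF x]
  have "kron (xket x) (1\<^sub>m d) * \<rho> x = kron (xket x) (1\<^sub>m d) * kron (1\<^sub>m 1) (\<rho> x)" by simp
  also have "\<dots> = kron (xket x) (\<rho> x)"
    unfolding kron_mult[OF k one_carrier_mat one_carrier_mat r]
    using right_mult_one_mat[OF k] left_mult_one_mat[OF r] by simp
  also have "\<dots> * adj (kron (xket x) (1\<^sub>m d)) = kron (xproj x) (\<rho> x)"
    unfolding adj_kron adj_one kron_mult[OF k adj_carrier[OF k] r one_carrier_mat] xproj_def
    using right_mult_one_mat[OF r] by simp
  finally show "kron (xproj x) (\<rho> x) = kron (xket x) (1\<^sub>m d) * \<rho> x * adj (kron (xket x) (1\<^sub>m d))" ..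
qed

section \<open>Lower bound on the max-entropy\<close>

lemma smult_smult_times: "a \<cdot>\<^sub>m (b \<cdot>\<^sub>m A) = (a * b) \<cdot>\<^sub>m (A :: 'a :: semigroup_mult mat)"
  by (rule eq_matI) (auto simp: mult.assoc)

text \<open>For the chosen \<sigma> the real part of the trace already gives the value
  \<open>t\<close>: the blocks of the first root sum to \<open>R\<close>, and the second root is a
  multiple of identity tensor \<open>R\<close>. Positivity of \<open>t\<close> is what allows
  \<sigma> to be normalized.\<close>

lemma H_max_ge:
  fixes \<rho> :: "bit vec \<Rightarrow> complex mat"
  assumes \<rho>: "\<And>x. x \<in> carrier_vec n \<Longrightarrow> psd d (\<rho> x)"
    and R_def: "R = msum d (\<lambda>x. msqrt (\<rho> x)) (carrier_vec n)"
    and t_def: "t = Re (mtrace (R * R))" and t: "0 < t"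
  shows "ereal (log 2 t) \<le> H_max n d (cq_operator n d \<rho>)"
proof -
  have r: "psd d (msqrt (\<rho> x))" if "x \<in> carrier_vec n" for x
    using psd_msqrt[OF \<rho>[OF that]] by blast
  have R: "psd d R" unfolding R_def using r by (rule psd_msum)
  note Rc = psd_carrier[OF R]
  have RR: "psd d (R * R)" using psd_gram[OF Rc] by (simp add: psd_hermitian[OF R])
  define \<sigma> where "\<sigma> = complex_of_real (1 / t) \<cdot>\<^sub>m (R * R)"
  have "psd d \<sigma>" unfolding \<sigma>_def using RR t by (intro psd_smult) auto
  moreover have "mtrace \<sigma> = 1"
    using mtrace_smult[OF psd_carrier[OF RR], of "complex_of_real (1 / t)"] mtrace_psd[OF RR] t
    by (simp add: \<sigma>_def flip: t_def)
  ultimately have \<sigma>: "normalized_state d \<sigma>" by (simp add: normalized_state_def)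
  \<comment> \<open>Chosen so that \<tau> = \<open>c\<close> times \<open>R\<close> squares to
    \<sigma> / \<open>2 ^ n\<close>. The weight of the maximally mixed state is thereby absorbed
    into \<tau>, and the factor \<open>2 ^ n\<close> in the entropy restores it:
    \<open>2 ^ n * (c * t)\<^sup>2 = t\<close>.\<close>
  define c where "c = 1 / sqrt (2 ^ n * t)"
  have c: "0 \<le> c" "c * c = 1 / (2 ^ n * t)" using t by (auto simp: c_def)
  define \<tau> where "\<tau> = complex_of_real c \<cdot>\<^sub>m R"
  have \<tau>: "psd d \<tau>" unfolding \<tau>_def using R c(1) by (rule psd_smult)
  note \<tau>c = psd_carrier[OF \<tau>]
  define K where "K = kron (1\<^sub>m (2 ^ n)) \<tau>"
  have K: "psd (2 ^ n * d) K" unfolding K_def using \<tau> by (rule psd_kron_one)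
  have KK: "K * K = kron ((1 / 2 ^ n) \<cdot>\<^sub>m 1\<^sub>m (2 ^ n)) \<sigma>"
  proof -
    have "K * K = kron (1\<^sub>m (2 ^ n)) (\<tau> * \<tau>)"
      unfolding K_def kron_mult[OF one_carrier_mat one_carrier_mat \<tau>c \<tau>c]
      using left_mult_one_mat[OF one_carrier_mat] by simp
    also have "\<tau> * \<tau> = complex_of_real (c * c) \<cdot>\<^sub>m (R * R)"
      unfolding \<tau>_def mult_smult_assoc_mat[OF Rc smult_carrier_mat[OF Rc]] mult_smult_distrib[OF Rc Rc]
      by (simp add: smult_smult_times)
    also have "\<dots> = (1 / 2 ^ n) \<cdot>\<^sub>m \<sigma>"
      by (simp add: \<sigma>_def smult_smult_times c(2))
    finally show ?thesis by (simp add: kron_smult_left)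
  qed
  define S where "S = msqrt (cq_operator n d \<rho>) * msqrt (kron ((1 / 2 ^ n) \<cdot>\<^sub>m 1\<^sub>m (2 ^ n)) \<sigma>)"
  have S: "S = x_basis.blocks n d (\<lambda>x. msqrt (\<rho> x)) * K"
    using cq_operator_blocks[of n \<rho> d, OF psd_carrier[OF \<rho>]] x_basis.msqrt_blocks[of n d \<rho>, OF \<rho>]
    by (simp add: S_def msqrt_eq[OF K KK])
  have CK: "adj (kron (xket x) (1\<^sub>m d)) * K * kron (xket x) (1\<^sub>m d) = \<tau>" if x: "x \<in> carrier_vec n" for x
  proof -
    note k = xket_carrier[OF x]
    have "adj (kron (xket x) (1\<^sub>m d)) * K * kron (xket x) (1\<^sub>m d)
        = kron (adj (xket x) * 1\<^sub>m (2 ^ n) * xket x) (1\<^sub>m d * \<tau> * 1\<^sub>m d)"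
      unfolding adj_kron adj_one K_def kron_mult[OF adj_carrier[OF k] one_carrier_mat one_carrier_mat \<tau>c]
      by (rule kron_mult[OF mult_carrier_mat[OF adj_carrier[OF k] one_carrier_mat] k
          mult_carrier_mat[OF one_carrier_mat \<tau>c] one_carrier_mat])
    also have "\<dots> = kron (1\<^sub>m 1) \<tau>"
      unfolding right_mult_one_mat[OF adj_carrier[OF k]] xket_ortho[OF x x] left_mult_one_mat[OF \<tau>c]
        right_mult_one_mat[OF \<tau>c] by simp
    finally show ?thesis by simp
  qed
  have "mtrace S = (\<Sum>x\<in>carrier_vec n. mtrace (msqrt (\<rho> x) * \<tau>))"
    using x_basis.mtrace_blocks_mult[where n = n and d = d and r = "\<lambda>x. msqrt (\<rho> x)",
        OF psd_carrier[OF r] psd_carrier[OF K]]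
    by (simp add: S CK)
  also have "\<dots> = mtrace (msum d (\<lambda>x. msqrt (\<rho> x) * \<tau>) (carrier_vec n))"
    by (rule mtrace_msum[symmetric]) (intro mult_carrier_mat[OF psd_carrier[OF r] \<tau>c])
  also have "\<dots> = mtrace (R * \<tau>)"
    unfolding R_def by (subst msum_mult[OF \<tau>c psd_carrier[OF r]]) auto
  also have "\<dots> = complex_of_real c * mtrace (R * R)"
    unfolding \<tau>_def mult_smult_distrib[OF Rc Rc] by (rule mtrace_smult[OF psd_carrier[OF RR]])
  finally have "Re (mtrace S) = c * t" by (simp add: t_def)
  moreover have "Re (mtrace S) \<le> trace_norm S"
    unfolding S by (rule Re_mtrace_le_trace_norm[OF mult_carrier_mat[OF x_basis.blocks_carrier psd_carrier[OF K]]])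
  ultimately have "(c * t)\<^sup>2 \<le> (trace_norm S)\<^sup>2" using c(1) t by (intro power_mono) auto
  then have "2 ^ n * (c * t)\<^sup>2 \<le> 2 ^ n * (trace_norm S)\<^sup>2" by (intro mult_left_mono) auto
  moreover have "2 ^ n * (c * t)\<^sup>2 = t"
  proof -
    have "2 ^ n * (c * t)\<^sup>2 = 2 ^ n * t\<^sup>2 * (c * c)" by (simp add: power2_eq_square mult_ac)
    also have "\<dots> = t" unfolding c(2) using t by (simp add: power2_eq_square)
    finally show ?thesis .
  qed
  ultimately have "t \<le> 2 ^ n * (trace_norm S)\<^sup>2" by simp
  then have "ereal (log 2 t) \<le> log2_ereal (2 ^ n * (trace_norm S)\<^sup>2)"
    using t by (simp add: log2_ereal_def)
  also have "\<dots> \<le> H_max n d (cq_operator n d \<rho>)"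
    unfolding H_max_def S_def using \<sigma> by (intro SUP_upper) simp
  finally show ?thesis .
qed

subsection \<open>Compression by a fixed function\<close>

lemma psd_add:
  assumes "psd n A" "psd n B"
  shows "psd n (A + B)"
  unfolding psd_alt
proof (intro conjI allI)
  note c = psd_carrier[OF assms(1)] psd_carrier[OF assms(2)]
  then show "A + B \<in> carrier_mat n n" by simp
  fix v
  have "(\<Sum>i<n. \<Sum>j<n. cnj (v i) * (A + B) $$ (i, j) * v j)
      = (\<Sum>i<n. \<Sum>j<n. cnj (v i) * A $$ (i, j) * v j) + (\<Sum>i<n. \<Sum>j<n. cnj (v i) * B $$ (i, j) * v j)"
    using c by (simp add: ring_distribs sum.distrib)
  also have "\<dots> \<ge> 0"
    using assms unfolding psd_alt by (intro add_nonneg_nonneg) simp_all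
  finally show "0 \<le> (\<Sum>i<n. \<Sum>j<n. cnj (v i) * (A + B) $$ (i, j) * v j)" .
qed

lemma psd_zero [simp]: "psd n (0\<^sub>m n n)"
  by (simp add: psd_alt)

lemma mtrace_add:
  "A \<in> carrier_mat n n \<Longrightarrow> B \<in> carrier_mat n n \<Longrightarrow> mtrace (A + B) = mtrace A + mtrace B"
  by (simp add: mtrace_def sum.distrib)

text \<open>The missing part of the identity is added to the outcome \<open>0\<^sub>v n\<close>,
  whether or not it lies in \<open>J\<close>. It is enough to record that no element of
  \<open>J\<close> gets a smaller operator, since enlarging an operator cannot lower the probability
  of the correct outcome.\<close>

lemma povm_of_subnormalized:
  assumes J: "J \<subseteq> carrier_vec n" and M: "\<And>x. x \<in> J \<Longrightarrow> psd d (M x)"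
    and compl: "psd d (1\<^sub>m d - msum d M J)"
  obtains M' where "povm n d M'" "\<And>x. x \<in> J \<Longrightarrow> \<exists>D. psd d D \<and> M' x = M x + D"
proof
  define E where "E x = (if x = 0\<^sub>v n then 1\<^sub>m d - msum d M J else 0\<^sub>m d d)" for x :: "bit vec"
  define M' where "M' x = (if x \<in> J then M x else 0\<^sub>m d d) + E x" for x
  have E: "psd d (E x)" for x using compl by (simp add: E_def)
  note Ec = psd_carrier[OF E]
  have "psd d (M' x)" for x
    using M E by (auto simp: M'_def intro: psd_add)
  moreover have "msum d M' (carrier_vec n) = 1\<^sub>m d"
  proof (rule eq_matI)
    fix i j assume "i < dim_row (1\<^sub>m d :: complex mat)" "j < dim_col (1\<^sub>m d :: complex mat)"
    then have ij: "i < d" "j < d" by auto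
    have "M' x $$ (i, j) = (if x \<in> J then M x $$ (i, j) else 0)
        + (if x = 0\<^sub>v n then 1\<^sub>m d $$ (i, j) - msum d M J $$ (i, j) else 0)" for x
      using ij Ec[of x] psd_carrier[OF M, of x] by (auto simp: M'_def E_def msum_def)
    then have "(\<Sum>x\<in>carrier_vec n. M' x $$ (i, j))
        = (\<Sum>x\<in>carrier_vec n. if x \<in> J then M x $$ (i, j) else 0) + (1\<^sub>m d $$ (i, j) - msum d M J $$ (i, j))"
      by (simp add: sum.distrib sum.delta finite_bit_vecs del: index_one_mat)
    also have "(\<Sum>x\<in>carrier_vec n. if x \<in> J then M x $$ (i, j) else 0) = (\<Sum>x\<in>J. M x $$ (i, j))"
      using J by (simp add: sum.inter_restrict[OF finite_bit_vecs, symmetric] Int_absorb1)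
    also have "\<dots> = msum d M J $$ (i, j)" using ij by (simp add: msum_def)
    finally show "msum d M' (carrier_vec n) $$ (i, j) = 1\<^sub>m d $$ (i, j)"
      using ij by (simp add: msum_def)
  qed (simp_all add: msum_def)
  ultimately show "povm n d M'" by (simp add: povm_def)
  show "\<exists>D. psd d D \<and> M' x = M x + D" if "x \<in> J" for x
    using that E by (auto simp: M'_def)
qed

lemma Q_EC_eq_Q_DC: "Q_EC n k d g \<rho> = Q_DC n k d g \<rho>"
proof -
  have "{e \<in> carrier_vec n. x + e \<noteq> 0\<^sub>v n} = {e \<in> carrier_vec n. e \<noteq> x}" if "x \<in> carrier_vec n" for x :: "bit vec"
    using bit_vec_add_eq_zero_iff[OF that] by auto
  then show ?thesis by (simp add: Q_EC_def Q_DC_def)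
qed

text \<open>Different syndromes are decoded independently, so each class \<open>J s\<close> has its
  own square-root measurement, and only pairs in the same class contribute.\<close>

lemma Q_DC_le_collisions:
  fixes \<rho> :: "bit vec \<Rightarrow> complex mat"
  assumes \<rho>: "\<And>x. x \<in> carrier_vec n \<Longrightarrow> psd d (\<rho> x)"
    and g: "\<And>x. x \<in> carrier_vec n \<Longrightarrow> g x \<in> carrier_vec k"
  shows "Q_DC n k d g \<rho> \<le> (\<Sum>x\<in>carrier_vec n. \<Sum>y\<in>carrier_vec n - {x}.
    of_bool (g y = g x) * Re (mtrace (msqrt (\<rho> x) * msqrt (\<rho> y))))"
proof -
  define V :: "bit vec set" where "V = carrier_vec n"
  have V: "finite V" by (simp add: V_def finite_bit_vecs)
  define r where "r x = msqrt (\<rho> x)" for x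
  have r: "psd d (r x)" "r x * r x = \<rho> x" if "x \<in> V" for x
    using psd_msqrt[OF \<rho>] that by (auto simp: r_def V_def)
  define J where "J s = {x \<in> V. g x = s}" for s
  define err where "err M = (\<Sum>x\<in>V. \<Sum>e\<in>{e\<in>V. e \<noteq> x}. Re (mtrace (\<rho> x * M (g x) e)))" for M
  \<comment> \<open>Stated for every \<open>s\<close>; if no string has this syndrome,
    \<open>J s\<close> is empty and the completion alone supplies a POVM.\<close>
  have "\<exists>M. povm n d M \<and> (\<forall>x\<in>J s. Re (mtrace (\<rho> x)) - Re (mtrace (\<rho> x * M x))
      \<le> (\<Sum>y\<in>J s - {x}. Re (mtrace (r x * r y))))" for s
  proof -
    have J: "finite (J s)" "J s \<subseteq> carrier_vec n" using V by (auto simp: J_def V_def)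
    have rJ: "psd d (r x)" if "x \<in> J s" for x using r that by (simp add: J_def)
    obtain M where M: "\<And>x. x \<in> J s \<Longrightarrow> psd d (M x)" "psd d (1\<^sub>m d - msum d M (J s))"
      and le: "\<And>x. x \<in> J s \<Longrightarrow> Re (mtrace (r x * r x)) - Re (mtrace (r x * r x * M x))
        \<le> (\<Sum>y\<in>J s - {x}. Re (mtrace (r x * r y)))"
      using square_root_measurement[where r = r and n = d, OF J(1) rJ] by blast
    obtain M' where M': "povm n d M'" and D: "\<And>x. x \<in> J s \<Longrightarrow> \<exists>D. psd d D \<and> M' x = M x + D"
      using povm_of_subnormalized[of "J s" n d M, OF J(2) M] by blast
    have "Re (mtrace (\<rho> x)) - Re (mtrace (\<rho> x * M' x)) \<le> (\<Sum>y\<in>J s - {x}. Re (mtrace (r x * r y)))"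
      if x: "x \<in> J s" for x
    proof -
      obtain D where D: "psd d D" "M' x = M x + D" using D[OF x] by blast
      have \<rho>x: "psd d (\<rho> x)" using x \<rho> by (simp add: J_def V_def)
      note c = psd_carrier[OF \<rho>x] psd_carrier[OF M(1)[OF x]] psd_carrier[OF D(1)]
      have "mtrace (\<rho> x * M' x) = mtrace (\<rho> x * M x) + mtrace (\<rho> x * D)"
        unfolding D(2) mult_add_distrib_mat[OF c]
        by (rule mtrace_add[OF mult_carrier_mat[OF c(1,2)] mult_carrier_mat[OF c(1,3)]])
      moreover have "r x * r x = \<rho> x" using x r by (simp add: J_def)
      ultimately show ?thesis using le[OF x] mtrace_mult_nonneg[OF \<rho>x D(1)] by simp
    qed
    with M' show ?thesis by blast
  qed
  then obtain M where M: "\<And>s. povm n d (M s)" and le: "\<And>s x. x \<in> J s \<Longrightarrow>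
      Re (mtrace (\<rho> x)) - Re (mtrace (\<rho> x * M s x)) \<le> (\<Sum>y\<in>J s - {x}. Re (mtrace (r x * r y)))"
    by metis
  \<comment> \<open>An infimum of reals lies below its members only for a set bounded below;
    nonnegativity of the objective provides the bound.\<close>
  have "0 \<le> err M'" if M': "M' \<in> povm_families n k d" for M'
    unfolding err_def
  proof (intro sum_nonneg mtrace_mult_nonneg)
    fix x e assume "x \<in> V" "e \<in> {e\<in>V. e \<noteq> x}"
    then show "psd d (\<rho> x)" "psd d (M' (g x) e)"
      using \<rho> g M' by (auto simp: V_def povm_families_def povm_def)
  qed
  then have "bdd_below (err ` povm_families n k d)" by (auto intro!: bdd_belowI2)
  moreover have "M \<in> povm_families n k d" using M by (simp add: povm_families_def)
  ultimately have "Q_DC n k d g \<rho> \<le> err M"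
    unfolding Q_DC_def err_def V_def by (rule cINF_lower)
  \<comment> \<open>The operators of a POVM sum to the identity, so the wrong outcomes carry the
    whole of Tr \<open>\<rho> x\<close> except the share of the correct one.\<close>
  also have "err M = (\<Sum>x\<in>V. Re (mtrace (\<rho> x)) - Re (mtrace (\<rho> x * M (g x) x)))"
    unfolding err_def
  proof (rule sum.cong[OF refl])
    fix x assume x: "x \<in> V"
    have c: "\<rho> x \<in> carrier_mat d d" using psd_carrier[OF \<rho>] x by (simp add: V_def)
    have Mc: "M (g x) e \<in> carrier_mat d d" if "e \<in> V" for e
      using M that by (auto simp: povm_def V_def psd_carrier)
    have "\<rho> x = \<rho> x * msum d (M (g x)) V"
      using M[of "g x"] c by (simp add: povm_def V_def)
    also have "\<dots> = msum d (\<lambda>e. \<rho> x * M (g x) e) V"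
      by (rule mult_msum[OF c Mc])
    finally have "mtrace (\<rho> x) = mtrace (msum d (\<lambda>e. \<rho> x * M (g x) e) V)" by simp
    also have "\<dots> = (\<Sum>e\<in>V. mtrace (\<rho> x * M (g x) e))"
      by (rule mtrace_msum[OF mult_carrier_mat[OF c Mc]])
    finally have "Re (mtrace (\<rho> x)) = (\<Sum>e\<in>V. Re (mtrace (\<rho> x * M (g x) e)))" by simp
    moreover have "{e\<in>V. e \<noteq> x} = V - {x}" by auto
    ultimately show "(\<Sum>e\<in>{e\<in>V. e \<noteq> x}. Re (mtrace (\<rho> x * M (g x) e)))
        = Re (mtrace (\<rho> x)) - Re (mtrace (\<rho> x * M (g x) x))"
      using sum.remove[OF V x, of "\<lambda>e. Re (mtrace (\<rho> x * M (g x) e))"] by simp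
  qed
  also have "\<dots> \<le> (\<Sum>x\<in>V. \<Sum>y\<in>J (g x) - {x}. Re (mtrace (r x * r y)))"
    using le by (intro sum_mono) (simp add: J_def)
  also have "\<dots> = (\<Sum>x\<in>V. \<Sum>y\<in>V - {x}. of_bool (g y = g x) * Re (mtrace (r x * r y)))"
  proof (rule sum.cong[OF refl])
    fix x
    have "J (g x) - {x} = (V - {x}) \<inter> {y. g y = g x}" by (auto simp: J_def)
    then show "(\<Sum>y\<in>J (g x) - {x}. Re (mtrace (r x * r y)))
        = (\<Sum>y\<in>V - {x}. of_bool (g y = g x) * Re (mtrace (r x * r y)))"
      using V by simp
  qed
  finally show ?thesis by (simp add: V_def r_def)
qed

subsection \<open>Averaging\<close>

text \<open>By linearity a collision means that \<open>y + x\<close> is mapped to 0, and over the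
  two-element field this sum is nonzero for distinct strings. Linearity holds only on the support of
  \<open>G\<close>, so the two events are compared after intersecting with it.\<close>

lemma collision_prob_le:
  assumes G: "linear_random_function n k G" and univ: "almost_universal2 n k \<delta> G"
    and x: "x \<in> carrier_vec n" and y: "y \<in> carrier_vec n" and xy: "x \<noteq> y"
  shows "measure_pmf.prob G {g. g y = g x} \<le> 2 powr (- real k) * \<delta>"
proof -
  have "g y = g x \<longleftrightarrow> g (y + x) = 0\<^sub>v k" if "g \<in> set_pmf G" for g
  proof -
    have g: "linear_fun n k g" using G that by (simp add: linear_random_function_def)
    show ?thesis
      using linear_fun_add(2)[OF g y x] bit_vec_add_eq_zero_iff[OF linear_fun_add(1)[OF g y x] linear_fun_add(1)[OF g x x]]
      by simp
  qed
  then have "{g. g y = g x} \<inter> set_pmf G = {g. g (y + x) = 0\<^sub>v k} \<inter> set_pmf G" by auto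
  then have "measure_pmf.prob G {g. g y = g x} = measure_pmf.prob G {g. g (y + x) = 0\<^sub>v k}"
    using measure_Int_set_pmf[of G "{g. g y = g x}"] measure_Int_set_pmf[of G "{g. g (y + x) = 0\<^sub>v k}"]
    by (simp only:)
  moreover have "y + x \<in> carrier_vec n" "y + x \<noteq> 0\<^sub>v n"
    using x y xy bit_vec_add_eq_zero_iff[OF y x] by auto
  ultimately show ?thesis using univ by (simp add: almost_universal2_def)
qed

text \<open>The coefficients \<open>c x y\<close> do not depend on the function and are nonnegative,
  so each collision indicator can be averaged and bounded separately.\<close>

lemma expectation_Q_DC_le:
  fixes \<rho> :: "bit vec \<Rightarrow> complex mat"
  assumes G: "linear_random_function n k G" and univ: "almost_universal2 n k \<delta> G" and \<delta>: "0 \<le> \<delta>"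
    and \<rho>: "\<And>x. x \<in> carrier_vec n \<Longrightarrow> psd d (\<rho> x)"
    and R_def: "R = msum d (\<lambda>x. msqrt (\<rho> x)) (carrier_vec n)"
  shows "measure_pmf.expectation G (\<lambda>g. Q_DC n k d g \<rho>) \<le> 2 powr (- real k) * \<delta> * Re (mtrace (R * R))"
proof -
  define V :: "bit vec set" where "V = carrier_vec n"
  have V: "finite V" by (simp add: V_def finite_bit_vecs)
  define r where "r x = msqrt (\<rho> x)" for x
  have r: "psd d (r x)" if "x \<in> V" for x
    using psd_msqrt[OF \<rho>] that by (auto simp: r_def V_def)
  note rc = psd_carrier[OF r]
  have R: "R = msum d r V" unfolding R_def r_def V_def ..
  define c where "c x y = Re (mtrace (r x * r y))" for x y
  have c: "0 \<le> c x y" if "x \<in> V" "y \<in> V" for x y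
    using mtrace_mult_nonneg[OF r r] that by (simp add: c_def)
  have fin: "finite (set_pmf G)" using G by (simp add: linear_random_function_def)
  note int = integrable_measure_pmf_finite[OF fin]
  have "AE g in measure_pmf G. Q_DC n k d g \<rho> \<le> (\<Sum>x\<in>V. \<Sum>y\<in>V - {x}. of_bool (g y = g x) * c x y)"
    unfolding AE_measure_pmf_iff
  proof
    fix g assume "g \<in> set_pmf G"
    then have g: "linear_fun n k g" using G by (simp add: linear_random_function_def)
    show "Q_DC n k d g \<rho> \<le> (\<Sum>x\<in>V. \<Sum>y\<in>V - {x}. of_bool (g y = g x) * c x y)"
      using Q_DC_le_collisions[of n d \<rho> g k, OF \<rho> linear_fun_add(1)[OF g]]
      by (simp add: V_def c_def r_def)
  qed
  then have "measure_pmf.expectation G (\<lambda>g. Q_DC n k d g \<rho>)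
      \<le> measure_pmf.expectation G (\<lambda>g. \<Sum>x\<in>V. \<Sum>y\<in>V - {x}. of_bool (g y = g x) * c x y)"
    by (intro integral_mono_AE int)
  also have "\<dots> = (\<Sum>x\<in>V. \<Sum>y\<in>V - {x}. measure_pmf.prob G {g. g y = g x} * c x y)"
  proof -
    have "measure_pmf.expectation G (\<lambda>g. of_bool (g y = g x) :: real) = measure_pmf.prob G {g. g y = g x}" for x y
    proof -
      have "(\<lambda>g :: bit vec \<Rightarrow> bit vec. of_bool (g y = g x) :: real) = indicator {g. g y = g x}"
        by (auto simp: indicator_def)
      then show ?thesis by simp
    qed
    then show ?thesis by (simp add: Bochner_Integration.integral_sum int)
  qed
  also have "\<dots> \<le> (\<Sum>x\<in>V. \<Sum>y\<in>V - {x}. 2 powr (- real k) * \<delta> * c x y)"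
    using collision_prob_le[OF G univ] c by (intro sum_mono mult_right_mono) (auto simp: V_def)
  \<comment> \<open>Adding the diagonal terms, nonnegative because \<delta> is, completes the sum to
    the expansion of Tr \<open>R * R\<close>.\<close>
  also have "\<dots> \<le> (\<Sum>x\<in>V. \<Sum>y\<in>V. 2 powr (- real k) * \<delta> * c x y)"
    using V c \<delta> by (intro sum_mono sum_mono2) auto
  also have "\<dots> = 2 powr (- real k) * \<delta> * Re (mtrace (R * R))"
  proof -
    have "mtrace (R * R) = (\<Sum>x\<in>V. mtrace (r x * R))"
      unfolding R by (subst msum_mult[OF msum_carrier rc], assumption,
        rule mtrace_msum[OF mult_carrier_mat[OF rc msum_carrier]])
    also have "\<dots> = (\<Sum>x\<in>V. \<Sum>y\<in>V. mtrace (r x * r y))"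
      unfolding R
    proof (rule sum.cong[OF refl])
      fix x assume x: "x \<in> V"
      have "r x * msum d r V = msum d (\<lambda>y. r x * r y) V" by (rule mult_msum[OF rc[OF x] rc])
      then show "mtrace (r x * msum d r V) = (\<Sum>y\<in>V. mtrace (r x * r y))"
        using mtrace_msum[OF mult_carrier_mat[OF rc[OF x] rc]] by simp
    qed
    finally show ?thesis by (simp add: c_def sum_distrib_left)
  qed
  finally show ?thesis .
qed

lemma pow2_ereal_mono: "h \<le> h' \<Longrightarrow> pow2_ereal h \<le> pow2_ereal h'"
  by (cases h; cases h') (auto simp: pow2_ereal_def)

lemma pow2_ereal_nonneg: "0 \<le> pow2_ereal h"
  by (cases h) (auto simp: pow2_ereal_def)

theorem lemma9:
  fixes n m d :: nat and \<delta> :: real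
    and G :: "(bit vec \<Rightarrow> bit vec) pmf" and \<rho> :: "bit vec \<Rightarrow> complex mat"
  assumes "m \<le> n"
    and "linear_random_function n (n - m) G"
    and "\<And>g. g \<in> set_pmf G \<Longrightarrow> g ` carrier_vec n = carrier_vec (n - m)"
    and "almost_universal2 n (n - m) \<delta> G"
    and "n = 0 \<Longrightarrow> 0 \<le> \<delta>"
    and "\<And>x. x \<in> carrier_vec n \<Longrightarrow> \<rho> x \<in> carrier_mat d d"
    and "subnormalized_state (2 ^ n * d) (cq_operator n d \<rho>)"
  shows "measure_pmf.expectation G (\<lambda>g. Q_EC n (n - m) d g \<rho>)
           = measure_pmf.expectation G (\<lambda>g. Q_DC n (n - m) d g \<rho>)
         \<and> ereal (measure_pmf.expectation G (\<lambda>g. Q_DC n (n - m) d g \<rho>))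
           \<le> pow2_ereal (H_max n d (cq_operator n d \<rho>) - ereal (real (n - m))) * ereal \<delta>"
proof
  show "measure_pmf.expectation G (\<lambda>g. Q_EC n (n - m) d g \<rho>)
      = measure_pmf.expectation G (\<lambda>g. Q_DC n (n - m) d g \<rho>)"
    by (simp add: Q_EC_eq_Q_DC)
  have \<delta>: "0 \<le> \<delta>"
    using almost_universal2_nonneg[OF assms(4)] assms(5) by (cases "n = 0") auto
  have "psd (2 ^ n * d) (x_basis.blocks n d \<rho>)"
    using assms(7) cq_operator_blocks[of n \<rho> d, OF assms(6)] by (simp add: subnormalized_state_def)
  then have \<rho>: "psd d (\<rho> x)" if "x \<in> carrier_vec n" for x
    using psd_conj[OF _ x_basis.C_carrier[OF that]] x_basis.conj_blocks[of n \<rho> d x, OF assms(6) that]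
    by metis
  define R where "R = msum d (\<lambda>x. msqrt (\<rho> x)) (carrier_vec n)"
  define t where "t = Re (mtrace (R * R))"
  let ?k = "n - m" and ?H = "H_max n d (cq_operator n d \<rho>)"
  let ?E = "measure_pmf.expectation G (\<lambda>g. Q_DC n ?k d g \<rho>)"
  have E: "?E \<le> 2 powr (- real ?k) * \<delta> * t"
    unfolding t_def by (rule expectation_Q_DC_le[OF assms(2,4) \<delta> \<rho> R_def])
  show "ereal ?E \<le> pow2_ereal (?H - ereal (real ?k)) * ereal \<delta>"
  proof (cases "0 < t")
    case True
    have "ereal ?E \<le> ereal (2 powr (log 2 t - real ?k)) * ereal \<delta>"
      using E True by (simp add: powr_diff powr_minus field_simps)
    also have "\<dots> = pow2_ereal (ereal (log 2 t) - ereal (real ?k)) * ereal \<delta>"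
      by (simp add: pow2_ereal_def)
    also have "\<dots> \<le> pow2_ereal (?H - ereal (real ?k)) * ereal \<delta>"
      using H_max_ge[of n d \<rho>, OF \<rho> R_def t_def True] \<delta>
      by (intro ereal_mult_right_mono pow2_ereal_mono ereal_minus_mono) auto
    finally show ?thesis .
  next
    \<comment> \<open>No \<sigma> proportional to \<open>R * R\<close> can be normalized here, and
      the entropy may be minus infinity. The average error is then at most 0, so nonnegativity of
      the right side is enough.\<close>
    case False
    then have "2 powr (- real ?k) * \<delta> * t \<le> 0"
      using \<delta> by (intro mult_nonneg_nonpos) auto
    then have "ereal ?E \<le> 0" using E by simp
    also have "\<dots> \<le> pow2_ereal (?H - ereal (real ?k)) * ereal \<delta>"
      using \<delta> by (simp add: pow2_ereal_nonneg)
    finally show ?thesis .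
  qed
qed

end
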